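(* Let $G=(V,E)$ be a finite simple connected unweighted graph with maximal vertex degree $D$, and let $0=\lambda_0<\lambda_1\le\lambda_2\le\dots$ be the eigenvalues (with multiplicity) of $-\Delta$, where $\Delta f(x)=\sum_{y\sim x}(f(y)-f(x))$. The following are equivalent: (1) $G$ is isomorphic to the $D$-dimensional hypercube $H_D$. (2) $G$ satisfies $CD(K,\infty)$ for some $K>0$ and $\lambda_D=K$. (3) $G$ satisfies $CD(K,\infty)$ for some $K>0$ and $\operatorname{diam}_d(G)=\frac{2D}{K}$.
   Context: For $f,g:V\to\mathbb R$: $2\Gamma(f,g)=\Delta(fg)-f\Delta g-g\Delta f$, $2\Gamma_2(f,g)=\Delta\Gamma(f,g)-\Gamma(f,\Delta g)-\Gamma(g,\Delta f)$, $\Gamma f=\Gamma(f,f)$, $\Gamma_2 f=\Gamma_2(f,f)$. $G$ satisfies $CD(K,\infty)$ if $\Gamma_2f(x)\ge K\Gamma f(x)$ for all $f$ and all $x\in V$. $\operatorname{diam}_d(G)$ is the maximum combinatorial (path-length) distance between vertices. $H_D$ is the graph with vertex set the power set of $\{1,\dots,D\}$, with $A\sim B$ iff their symmetric difference has exactly one element. *)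

theory Defs
  imports "HOL-Analysis.Analysis" "HOL-Computational_Algebra.Polynomial"
begin

definition simple_graph :: "('a \<Rightarrow> 'a \<Rightarrow> bool) \<Rightarrow> bool" where
  "simple_graph E \<longleftrightarrow> (\<forall>x y. E x y \<longrightarrow> E y x) \<and> (\<forall>x. \<not> E x x)"

definition connected_graph :: "('a \<Rightarrow> 'a \<Rightarrow> bool) \<Rightarrow> bool" where
  "connected_graph E \<longleftrightarrow> (\<forall>x y. E\<^sup>*\<^sup>* x y)"

definition degree :: "('a \<Rightarrow> 'a \<Rightarrow> bool) \<Rightarrow> 'a \<Rightarrow> nat" where
  "degree E x = card {y. E x y}"

definition max_degree :: "('a::finite \<Rightarrow> 'a \<Rightarrow> bool) \<Rightarrow> nat" where
  "max_degree E = Max (range (degree E))"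

definition lap :: "('a::finite \<Rightarrow> 'a \<Rightarrow> bool) \<Rightarrow> ('a \<Rightarrow> real) \<Rightarrow> 'a \<Rightarrow> real" where
  "lap E f x = (\<Sum>y\<in>{y. E x y}. (f y - f x))"

definition Gam :: "('a::finite \<Rightarrow> 'a \<Rightarrow> bool) \<Rightarrow> ('a \<Rightarrow> real) \<Rightarrow> ('a \<Rightarrow> real) \<Rightarrow> 'a \<Rightarrow> real" where
  "Gam E f g x = (lap E (\<lambda>z. f z * g z) x - f x * lap E g x - g x * lap E f x) / 2"

definition Gam2 :: "('a::finite \<Rightarrow> 'a \<Rightarrow> bool) \<Rightarrow> ('a \<Rightarrow> real) \<Rightarrow> ('a \<Rightarrow> real) \<Rightarrow> 'a \<Rightarrow> real" where
  "Gam2 E f g x = (lap E (Gam E f g) x - Gam E f (lap E g) x - Gam E g (lap E f) x) / 2"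

definition CD_inf :: "('a::finite \<Rightarrow> 'a \<Rightarrow> bool) \<Rightarrow> real \<Rightarrow> bool" where
  "CD_inf E K \<longleftrightarrow> (\<forall>f x. Gam2 E f f x \<ge> K * Gam E f f x)"

definition gdist :: "('a \<Rightarrow> 'a \<Rightarrow> bool) \<Rightarrow> 'a \<Rightarrow> 'a \<Rightarrow> nat" where
  "gdist E x y = (LEAST n. (E ^^ n) x y)"

definition diam :: "('a::finite \<Rightarrow> 'a \<Rightarrow> bool) \<Rightarrow> nat" where
  "diam E = Max {gdist E x y | x y. True}"

definition neg_lap_matrix :: "('a::finite \<Rightarrow> 'a \<Rightarrow> bool) \<Rightarrow> real ^'a^'a" where
  "neg_lap_matrix E = (\<chi> x y. - lap E (\<lambda>z. if z = y then 1 else 0) x)"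

definition charpoly :: "real^'n^'n \<Rightarrow> real poly" where
  "charpoly A = det (\<chi> i j. (if i = j then [:0, 1:] else 0) - [:A $ i $ j:])"

definition eigenvalues :: "real^'n^'n \<Rightarrow> real list" where
  "eigenvalues A = (THE xs. sorted xs \<and> charpoly A = (\<Prod>x\<leftarrow>xs. [:-x, 1:]))"

definition lap_eigenvalues :: "('a::finite \<Rightarrow> 'a \<Rightarrow> bool) \<Rightarrow> real list" where
  "lap_eigenvalues E = eigenvalues (neg_lap_matrix E)"

definition iso_hypercube :: "('a \<Rightarrow> 'a \<Rightarrow> bool) \<Rightarrow> nat \<Rightarrow> bool" where
  "iso_hypercube E D \<longleftrightarrow> (\<exists>f. bij_betw f UNIV (Pow {1..D}) \<and>
      (\<forall>x y. E x y \<longleftrightarrow> card ((f x - f y) \<union> (f y - f x)) = 1))"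

end

theory Submission
  imports Defs
begin

text \<open>
  Let \<open>G\<close> satisfy \<open>CD(K,\<infinity>)\<close> and let \<open>\<Gamma> f \<le> D/2\<close>. For the resolvent \<open>g = (1 - \<Delta>)\<^sup>-\<^sup>1 f\<close> and \<open>h = (1 + K) g\<close>
  the curvature bound gives \<open>\<Gamma> h + \<Gamma>(f - h) \<le> \<Gamma> f + \<Delta>\<Gamma> h / (1 + K)\<close>. By the maximum principle \<open>\<Gamma> h \<le> D/2\<close>,
  and comparing the oscillation of \<open>f\<close> with that of \<open>h\<close> yields that it is at most \<open>2D/K\<close>; in the case of equality
  the inequality propagates from vertex to vertex and makes \<open>f\<close> an eigenfunction for \<open>K\<close>, up to a constant,
  with \<open>\<Gamma> f = D/2\<close> everywhere.

  (3) implies (1): apply this to the distance \<open>f\<close> from an endpoint \<open>r\<close> of a diameter. It forces \<open>K = 2\<close>,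
  regularity, bipartiteness, and exactly \<open>k\<close> lower neighbours at level \<open>k\<close>. As \<open>\<Gamma>\<^sub>2 f = K \<Gamma> f\<close>, the function \<open>f\<close> is in the
  kernel of \<open>\<Gamma>\<^sub>2 - K \<Gamma>\<close>; pairing it with point masses shows that two vertices of the same level have as many common
  upper as common lower neighbours, hence at most one of each. Testing \<open>CD(2,\<infinity>)\<close> on suitable functions then shows
  that vertices at distance two which lie two levels apart have exactly two common neighbours, and a vertex is
  determined by the set of neighbours of \<open>r\<close> below it.

  (2) implies (3): \<open>\<Gamma>\<close> is constant on eigenfunctions for \<open>K\<close>, so an eigenspace of dimension \<open>D\<close> realises every gradient at
  every vertex; the eigenfunction with gradient \<open>1\<close> at a vertex changes by \<open>\<plusminus>1\<close> along every edge and oscillates by \<open>2D/K\<close>.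

  (1) implies (2) and (3): on the hypercube, differences in different directions commute.
\<close>

subsection \<open>The carre du champ calculus\<close>

abbreviation nbrs :: "('a \<Rightarrow> 'a \<Rightarrow> bool) \<Rightarrow> 'a \<Rightarrow> 'a set" where
  "nbrs E x \<equiv> {y. E x y}"

abbreviation common_nbrs :: "('a \<Rightarrow> 'a \<Rightarrow> bool) \<Rightarrow> 'a \<Rightarrow> 'a \<Rightarrow> 'a set" where
  "common_nbrs E x z \<equiv> {y. E x y \<and> E y z}"

lemma lap_add_mult: "lap E (\<lambda>z. f z + c * g z) x = lap E f x + c * lap E g x"
  by (simp add: lap_def algebra_simps sum_distrib_left sum.distrib sum_subtractf)

lemma lap_mult: "lap E (\<lambda>z. c * g z) x = c * lap E g x"
  using lap_add_mult[of E "\<lambda>_. 0" c g x] by (simp add: lap_def)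

lemma lap_const: "lap E (\<lambda>z. c) x = 0"
  by (simp add: lap_def)

lemma lap_affine: "lap E (\<lambda>z. c + a * g z) x = a * lap E g x"
  using lap_add_mult[of E "\<lambda>_. c" a g x] by (simp add: lap_const)

lemma Gam_eq: "Gam E f g x = (\<Sum>y\<in>nbrs E x. (f y - f x) * (g y - g x)) / 2"
proof -
  have "lap E (\<lambda>z. f z * g z) x - f x * lap E g x - g x * lap E f x
    = (\<Sum>y\<in>nbrs E x. (f y * g y - f x * g x) - f x * (g y - g x) - g x * (f y - f x))"
    unfolding lap_def sum_distrib_left sum_subtractf[symmetric] by simp
  also have "\<dots> = (\<Sum>y\<in>nbrs E x. (f y - f x) * (g y - g x))"
    by (intro sum.cong) (auto simp: algebra_simps)
  finally show ?thesis by (simp add: Gam_def)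
qed

lemma Gam_self: "Gam E f f x = (\<Sum>y\<in>nbrs E x. (f y - f x)\<^sup>2) / 2"
  by (simp add: Gam_eq power2_eq_square)

lemma Gam_commute: "Gam E f g x = Gam E g f x"
  by (simp add: Gam_eq mult.commute)

lemma Gam_nonneg: "Gam E f f x \<ge> 0"
  by (simp add: Gam_self sum_nonneg)

lemma Gam_add_mult_left: "Gam E (\<lambda>z. f z + c * h z) g x = Gam E f g x + c * Gam E h g x"
proof -
  have "(\<Sum>y\<in>nbrs E x. (f y + c * h y - (f x + c * h x)) * (g y - g x)) =
    (\<Sum>y\<in>nbrs E x. (f y - f x) * (g y - g x)) + c * (\<Sum>y\<in>nbrs E x. (h y - h x) * (g y - g x))"
    unfolding sum_distrib_left sum.distrib[symmetric]
    by (intro sum.cong) (auto simp: algebra_simps)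
  then show ?thesis by (simp add: Gam_eq add_divide_distrib)
qed

lemma Gam_add_mult_right: "Gam E g (\<lambda>z. f z + c * h z) x = Gam E g f x + c * Gam E g h x"
  using Gam_add_mult_left[of E f c h g x] by (simp add: Gam_commute)

lemma Gam_const_right: "Gam E g (\<lambda>z. c) x = 0"
  by (simp add: Gam_eq)

lemma Gam_affine_right: "Gam E g (\<lambda>z. c + a * h z) x = a * Gam E g h x"
  using Gam_add_mult_right[of E g "\<lambda>_. c" a h x] by (simp add: Gam_const_right)

lemma Gam_affine: "Gam E (\<lambda>z. c + a * h z) (\<lambda>z. c + a * h z) x = a\<^sup>2 * Gam E h h x"
  unfolding Gam_affine_right Gam_commute[of E "\<lambda>z. c + a * h z"]
  by (simp add: power2_eq_square)

lemma Gam2_commute: "Gam2 E f g x = Gam2 E g f x"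
proof -
  have "Gam E f g = Gam E g f"
    by (rule ext) (rule Gam_commute)
  then show ?thesis by (simp add: Gam2_def)
qed

lemma Gam2_add_mult_left: "Gam2 E (\<lambda>z. f z + c * h z) g x = Gam2 E f g x + c * Gam2 E h g x"
proof -
  have 1: "Gam E (\<lambda>z. f z + c * h z) g = (\<lambda>x. Gam E f g x + c * Gam E h g x)"
    by (rule ext) (rule Gam_add_mult_left)
  have 2: "lap E (\<lambda>z. f z + c * h z) = (\<lambda>x. lap E f x + c * lap E h x)"
    by (rule ext) (rule lap_add_mult)
  show ?thesis
    unfolding Gam2_def 1 2 lap_add_mult Gam_add_mult_left Gam_add_mult_right
    by (simp add: field_simps)
qed

section \<open>The curvature form and its kernel\<close>

definition curv_form :: "('a::finite \<Rightarrow> 'a \<Rightarrow> bool) \<Rightarrow> real \<Rightarrow> ('a \<Rightarrow> real) \<Rightarrow> ('a \<Rightarrow> real) \<Rightarrow> 'a \<Rightarrow> real" where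
  "curv_form E K f g x = Gam2 E f g x - K * Gam E f g x"

lemma curv_form_commute: "curv_form E K f g x = curv_form E K g f x"
  by (simp add: curv_form_def Gam2_commute[of E f] Gam_commute[of E f])

lemma curv_form_add_mult_left:
  "curv_form E K (\<lambda>z. f z + c * h z) g x = curv_form E K f g x + c * curv_form E K h g x"
  by (simp add: curv_form_def Gam2_add_mult_left Gam_add_mult_left algebra_simps)

lemma curv_form_add_mult_right:
  "curv_form E K g (\<lambda>z. f z + c * h z) x = curv_form E K g f x + c * curv_form E K g h x"
  using curv_form_add_mult_left[of E K f c h g x] by (simp add: curv_form_commute)

lemma CD_inf_curv_form: "CD_inf E K \<Longrightarrow> curv_form E K f f x \<ge> 0"
  by (simp add: CD_inf_def curv_form_def)

text \<open>Near \<open>t = 0\<close> the linear term dominates the quadratic one, so a nonzero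
  \<open>b\<close> would produce negative values. This first-variation argument serves both the
  curvature form and Rayleigh quotients.\<close>

lemma psd_kernel:
  fixes b c :: real
  assumes "\<And>t. 2 * t * b + t\<^sup>2 * c \<ge> 0"
  shows "b = 0"
proof (rule ccontr)
  assume b: "b \<noteq> 0"
  \<comment> \<open>The test value is \<open>t = - s * b\<close>, with \<open>s\<close> so small
    that the quadratic term cannot compensate the linear one.\<close>
  define s where "s = 1 / (\<bar>c\<bar> + 1)"
  have s: "s > 0" "s * \<bar>c\<bar> < 1" by (auto simp: s_def field_simps)
  have "2 * (- s * b) * b + (- s * b)\<^sup>2 * c = s * b\<^sup>2 * (s * c - 2)"
    by (simp add: power2_eq_square algebra_simps)
  moreover have "s * c \<le> s * \<bar>c\<bar>" using s by (simp add: mult_left_mono)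
  then have "s * c - 2 < 0" using s by linarith
  moreover have "s * b\<^sup>2 > 0" using s b by simp
  ultimately have "2 * (- s * b) * b + (- s * b)\<^sup>2 * c < 0"
    by (simp add: mult_pos_neg)
  then show False using assms[of "- s * b"] by linarith
qed

text \<open>Equality in the curvature bound means that \<open>f\<close> minimises a nonnegative
  quadratic form, so the first variation in every direction \<open>h\<close> vanishes. Special
  choices of \<open>h\<close> turn this into linear identities for \<open>f\<close>.\<close>

lemma curv_form_kernel:
  assumes "CD_inf E K" "Gam2 E f f x = K * Gam E f f x"
  shows "curv_form E K f h x = 0"
proof (rule psd_kernel[where c = "curv_form E K h h x"])
  fix t
  have "curv_form E K (\<lambda>z. f z + t * h z) (\<lambda>z. f z + t * h z) x \<ge> 0"
    using assms by (rule_tac CD_inf_curv_form)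
  moreover have "curv_form E K f f x = 0"
    using assms by (simp add: curv_form_def)
  ultimately show "2 * t * curv_form E K f h x + t\<^sup>2 * curv_form E K h h x \<ge> 0"
    unfolding curv_form_add_mult_left curv_form_add_mult_right
    by (simp add: curv_form_commute[of E K h f] power2_eq_square algebra_simps)
qed

section \<open>Connectedness and the maximum principle\<close>

lemma connected_graph_induct:
  assumes "connected_graph E" "P x" "\<And>x y. P x \<Longrightarrow> E x y \<Longrightarrow> P y"
  shows "P y"
proof -
  have "E\<^sup>*\<^sup>* x y" using assms(1) by (simp add: connected_graph_def)
  then show ?thesis by (induction rule: rtranclp_induct) (use assms in auto)
qed

lemma connected_graph_constI:
  assumes "connected_graph E" "\<And>x y. E x y \<Longrightarrow> f x = f y"
  shows "f x = f y"
  by (rule connected_graph_induct[OF assms(1), where P = "\<lambda>z. f x = f z"]) (use assms(2) in auto)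

lemma ex_maximum:
  fixes f :: "'a::finite \<Rightarrow> 'b::linorder"
  obtains p where "\<And>x. f x \<le> f p"
proof -
  have "Max (range f) \<in> range f" by (rule Max_in) auto
  then obtain p where p: "Max (range f) = f p" by blast
  show ?thesis by (rule that[of p]) (simp add: p[symmetric])
qed

lemma lap_le_0_at_maximum: "(\<And>y. f y \<le> f x) \<Longrightarrow> lap E f x \<le> 0"
  unfolding lap_def by (intro sum_nonpos) simp

text \<open>At a maximum every summand of the Laplacian is nonpositive; a nonnegative sum forces
  each of them to vanish.\<close>

lemma maximum_nbr_eq:
  assumes "\<And>y. f y \<le> f x" "lap E f x \<ge> 0" "E x y"
  shows "f y = f x"
proof -
  have *: "(\<Sum>y\<in>nbrs E x. f x - f y) = - lap E f x"
    unfolding lap_def sum_negf[symmetric] by simp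
  have "(\<Sum>y\<in>nbrs E x. f x - f y) \<ge> 0" using assms(1) by (intro sum_nonneg) simp
  then have "(\<Sum>y\<in>nbrs E x. f x - f y) = 0" using assms(2) * by linarith
  then have "\<forall>y\<in>nbrs E x. f x - f y = 0"
    by (subst (asm) sum_nonneg_eq_0_iff) (use assms(1) in auto)
  then show ?thesis using assms(3) by auto
qed

text \<open>By \<open>maximum_nbr_eq\<close> the set of maximum points is closed under taking
  neighbours, hence everything.\<close>

lemma subharmonic_const:
  assumes "connected_graph E" "\<And>x. lap E f x \<ge> 0"
  shows "f x = f y"
proof -
  obtain p where p: "\<And>x. f x \<le> f p" using ex_maximum by blast
  have eq: "f z = f p" for z
  proof (rule connected_graph_induct[OF assms(1), where P = "\<lambda>z. f z = f p"])
    fix x y assume "f x = f p" "E x y"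
    then show "f y = f p" using maximum_nbr_eq[of f x E y] p assms(2) by simp
  qed simp
  show ?thesis by (rule trans[OF eq[of x] eq[of y, symmetric]])
qed

lemma Gam_zero_nbr:
  assumes "Gam E f f x = 0" "E x y"
  shows "f y = f x"
  using assms by (auto simp: Gam_self sum_nonneg_eq_0_iff)

lemma Gam_zero_const:
  assumes "connected_graph E" "\<And>x. Gam E f f x = 0"
  shows "f x = f y"
  by (rule connected_graph_constI[OF assms(1)]) (rule Gam_zero_nbr[OF assms(2), symmetric])

lemma lap_square_le: "(lap E f x)\<^sup>2 \<le> 2 * real (card (nbrs E x)) * Gam E f f x"
proof -
  have "(\<Sum>y\<in>nbrs E x. f y - f x)\<^sup>2 \<le> (\<Sum>y\<in>nbrs E x. 1\<^sup>2) * (\<Sum>y\<in>nbrs E x. (f y - f x)\<^sup>2)"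
    using Cauchy_Schwarz_ineq_sum[of "\<lambda>_. 1" "\<lambda>y. f y - f x" "nbrs E x"] by simp
  then show ?thesis by (simp add: lap_def Gam_self)
qed

section \<open>Eigenfunctions under the curvature bound\<close>

lemma Gam2_self: "2 * Gam2 E f f x = lap E (Gam E f f) x - 2 * Gam E f (lap E f) x"
  by (simp add: Gam2_def)

text \<open>For such \<open>f\<close> the definition of \<open>Gam2\<close> reads 2 \<Gamma>2 f =
  \<Delta>\<Gamma> f + 2 K \<Gamma> f. The curvature bound thus says that \<Gamma> f is subharmonic,
  hence constant; then \<Delta>\<Gamma> f = 0 and the bound is an equality. The constant
  \<open>c\<close> admits eigenfunctions shifted by a constant, such as distance functions.\<close>

lemma eigenfunction_Gam_const:
  assumes "connected_graph E" "CD_inf E K" "\<And>x. lap E f x = c - K * f x"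
  shows "Gam E f f x = Gam E f f y" and "Gam2 E f f x = K * Gam E f f x"
proof -
  have lf: "lap E f = (\<lambda>x. c + (- K) * f x)" using assms(3) by auto
  have *: "2 * Gam2 E f f x = lap E (Gam E f f) x + 2 * K * Gam E f f x" for x
    unfolding Gam2_self lf Gam_affine_right by simp
  have "lap E (Gam E f f) x \<ge> 0" for x
  proof -
    have "K * Gam E f f x \<le> Gam2 E f f x" using assms(2) by (simp add: CD_inf_def)
    then show ?thesis using *[of x] by linarith
  qed
  then have const: "Gam E f f x = Gam E f f y" for x y
    by (rule subharmonic_const[OF assms(1)])
  then show "Gam E f f x = Gam E f f y" .
  have "lap E (Gam E f f) x = 0"
    unfolding lap_def by (intro sum.neutral ballI, subst right_minus_eq, rule const)
  then show "Gam2 E f f x = K * Gam E f f x" using *[of x] by simp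
qed

text \<open>Lichnerowicz estimate: at a maximum of \<Gamma> f one has \<Delta>\<Gamma> f \<le> 0, so
  the identity for \<open>Gam2\<close> compares \<open>K\<close> with \<open>\<mu>\<close> there.
  Nonconstancy of \<open>f\<close> makes the maximum positive.\<close>

lemma eigenvalue_ge:
  assumes "connected_graph E" "CD_inf E K" "\<And>x. lap E f x = - (\<mu> * f x)" "f a \<noteq> f b"
  shows "\<mu> \<ge> K"
proof -
  have lf: "lap E f = (\<lambda>x. 0 + (- \<mu>) * f x)" using assms(3) by auto
  have *: "2 * Gam2 E f f x = lap E (Gam E f f) x + 2 * \<mu> * Gam E f f x" for x
    unfolding Gam2_self lf Gam_affine_right by simp
  obtain p where p: "\<And>x. Gam E f f x \<le> Gam E f f p" using ex_maximum by blast
  have "Gam E f f p \<noteq> 0"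
  proof
    assume "Gam E f f p = 0"
    then have "Gam E f f x = 0" for x using p[of x] Gam_nonneg[of E f x] by simp
    then show False using Gam_zero_const[OF assms(1)] assms(4) by blast
  qed
  then have pos: "Gam E f f p > 0" using Gam_nonneg[of E f p] by linarith
  have "2 * K * Gam E f f p \<le> 2 * \<mu> * Gam E f f p"
  proof -
    have "lap E (Gam E f f) p \<le> 0" using lap_le_0_at_maximum p by blast
    moreover have "K * Gam E f f p \<le> Gam2 E f f p" using assms(2) by (simp add: CD_inf_def)
    ultimately show ?thesis using *[of p] by linarith
  qed
  then show ?thesis using pos by simp
qed

subsection \<open>Curvature and the diameter\<close>

text \<open>The map 1 - \<Delta> is injective by the maximum principle, applied to a kernel element
  and to its negative; in finite dimension it is then onto.\<close>

lemma resolvent_ex: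
  fixes f :: "'a::finite \<Rightarrow> real"
  obtains g where "\<And>x. g x - lap E g x = f x"
proof -
  define T :: "real^'a \<Rightarrow> real^'a" where "T v = (\<chi> x. v $ x - lap E (\<lambda>z. v $ z) x)" for v
  have lin: "linear T"
  proof (rule linearI)
    show "T (a + b) = T a + T b" for a b
      using lap_add_mult[of E "\<lambda>z. a $ z" 1 "\<lambda>z. b $ z"] by (simp add: T_def vec_eq_iff)
    show "T (c *\<^sub>R a) = c *\<^sub>R T a" for c a
      by (simp add: T_def vec_eq_iff lap_mult algebra_simps)
  qed
  have nonpos: "u x \<le> 0" if "\<And>x. u x = lap E u x" for u :: "'a \<Rightarrow> real" and x
  proof -
    obtain p where p: "\<And>x. u x \<le> u p" using ex_maximum by blast
    have "u p \<le> 0" using lap_le_0_at_maximum[of u p E] p that[of p] by simp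
    then show ?thesis using p[of x] by simp
  qed
  have "inj T"
    unfolding linear_injective_0[OF lin]
  proof (intro allI impI)
    fix v assume v: "T v = 0"
    have *: "v $ x = lap E (\<lambda>z. v $ z) x" for x
    proof -
      have "T v $ x = 0" by (simp add: v)
      then show ?thesis by (simp add: T_def)
    qed
    have "v $ x \<le> 0" for x using nonpos[of "\<lambda>z. v $ z"] * by blast
    moreover have "- v $ x \<le> 0" for x
    proof (rule nonpos[of "\<lambda>z. - v $ z"])
      show "- v $ x = lap E (\<lambda>z. - v $ z) x" for x
        using lap_mult[of E "-1" "\<lambda>z. v $ z" x] *[of x] by simp
    qed
    ultimately show "v = 0" by (simp add: vec_eq_iff order_antisym)
  qed
  then have "surj T" using linear_injective_imp_surjective[OF lin] by simp
  then obtain v where "T v = (\<chi> x. f x)" by (metis surjD)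
  then have "v $ x - lap E (\<lambda>z. v $ z) x = f x" for x
    by (simp add: T_def vec_eq_iff)
  then show ?thesis by (rule that)
qed

text \<open>Inserting f = g - \<Delta> g gives \<Gamma>(g, f) = \<Gamma> g + \<Gamma>2 g -
  \<Delta>\<Gamma> g / 2, which the curvature bounds from below. The claim follows by expanding
  \<Gamma>(f - (1 + K) g).\<close>

lemma resolvent_Gam:
  assumes "CD_inf E K" "\<And>x. g x - lap E g x = f x" "K > 0"
  shows "(1 + K)\<^sup>2 * Gam E g g x + Gam E (\<lambda>z. f z + (- (1 + K)) * g z) (\<lambda>z. f z + (- (1 + K)) * g z) x
    \<le> Gam E f f x + (1 + K) * lap E (Gam E g g) x"
proof -
  have f: "f = (\<lambda>z. g z + (-1) * lap E g z)" using assms(2) by fastforce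
  have "Gam E g f x = Gam E g g x - Gam E g (lap E g) x"
    unfolding f Gam_add_mult_right by simp
  also have "\<dots> = Gam E g g x + Gam2 E g g x - lap E (Gam E g g) x / 2"
    using Gam2_self[of E g x] by simp
  also have "\<dots> \<ge> (1 + K) * Gam E g g x - lap E (Gam E g g) x / 2"
    using assms(1) by (simp add: CD_inf_def algebra_simps)
  finally have "2 * (1 + K) * Gam E g f x \<ge> 2 * (1 + K) * ((1 + K) * Gam E g g x - lap E (Gam E g g) x / 2)"
    using assms(3) by (intro mult_left_mono) auto
  moreover have "2 * (1 + K) * ((1 + K) * Gam E g g x - lap E (Gam E g g) x / 2)
    = 2 * (1 + K)\<^sup>2 * Gam E g g x - (1 + K) * lap E (Gam E g g) x"
    by (simp add: power2_eq_square algebra_simps)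
  ultimately have *: "2 * (1 + K) * Gam E g f x \<ge> 2 * (1 + K)\<^sup>2 * Gam E g g x - (1 + K) * lap E (Gam E g g) x"
    by simp
  have "Gam E (\<lambda>z. f z + (- (1 + K)) * g z) (\<lambda>z. f z + (- (1 + K)) * g z) x
    = Gam E f f x - 2 * (1 + K) * Gam E g f x + (1 + K)\<^sup>2 * Gam E g g x"
    unfolding Gam_add_mult_right Gam_add_mult_left
    by (simp only: Gam_commute[of E f g]) (simp add: algebra_simps power2_eq_square)
  then show ?thesis using * by linarith
qed

section \<open>Graph distance and Lipschitz functions\<close>

lemma relpowp_lipschitz:
  assumes "\<And>x y. E x y \<Longrightarrow> \<bar>f y - f x\<bar> \<le> (c::real)" "(E ^^ n) x y"
  shows "\<bar>f y - f x\<bar> \<le> n * c"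
  using assms(2)
proof (induction n arbitrary: y)
  case (Suc n)
  then obtain w where w: "(E ^^ n) x w" "E w y" by auto
  then show ?case using Suc.IH[OF w(1)] assms(1)[OF w(2)] by (simp add: algebra_simps)
qed simp

lemma gdist_relpowp:
  assumes "connected_graph E"
  shows "(E ^^ gdist E x y) x y"
proof -
  have "\<exists>n. (E ^^ n) x y" using assms rtranclp_power[of E x y] by (simp add: connected_graph_def)
  then show ?thesis unfolding gdist_def by (rule LeastI_ex)
qed

lemma gdist_le: "(E ^^ n) x y \<Longrightarrow> gdist E x y \<le> n"
  unfolding gdist_def by (rule Least_le)

lemma gdist_lipschitz:
  fixes f :: "'a \<Rightarrow> real" and c :: real
  assumes "connected_graph E" "\<And>x y. E x y \<Longrightarrow> \<bar>f y - f x\<bar> \<le> c"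
  shows "\<bar>f y - f x\<bar> \<le> gdist E x y * c"
  by (rule relpowp_lipschitz[OF assms(2) gdist_relpowp[OF assms(1)]])

lemma gdist_self [simp]: "gdist E x x = 0"
  using gdist_le[of 0 E x x] by simp

lemma gdist_eq_0_iff: "connected_graph E \<Longrightarrow> gdist E x y = 0 \<longleftrightarrow> x = y"
  using gdist_relpowp[of E x y] by auto

lemma gdist_nbr_le:
  assumes "connected_graph E" "E y z"
  shows "gdist E x z \<le> gdist E x y + 1"
  using gdist_le[of "Suc (gdist E x y)" E x z] gdist_relpowp[OF assms(1), of x y] assms(2) by auto

lemma gdist_le_diam: "gdist E x (y::'a::finite) \<le> diam E"
proof -
  have "finite {gdist E x y |x y. True}"
    by (rule finite_subset[of _ "(\<lambda>(x, y). gdist E x y) ` UNIV"]) auto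
  then show ?thesis unfolding diam_def by (intro Max_ge) auto
qed

lemma diam_attained: obtains x y :: "'a::finite" where "gdist E x y = diam E"
proof -
  have "finite {gdist E x y |x y. True}"
    by (rule finite_subset[of _ "(\<lambda>(x, y). gdist E x y) ` UNIV"]) auto
  then have "Max {gdist E x y |x y. True} \<in> {gdist E x y |x y. True}"
    by (rule Max_in) auto
  then show ?thesis using that by (auto simp: diam_def)
qed

section \<open>The sharp oscillation and diameter bounds\<close>

locale bakry_emery =
  fixes E :: "'a::finite \<Rightarrow> 'a \<Rightarrow> bool" and D :: nat and K :: real
  assumes symE: "E x y \<Longrightarrow> E y x"
    and irrefl: "\<not> E x x"
    and conn: "connected_graph E"
    and deg_le: "card (nbrs E x) \<le> D"
    and D_pos: "D > 0"
    and K_pos: "K > 0"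
    and CD: "CD_inf E K"
begin

text \<open>A crude estimate, whose purpose is to make the supremum in \<open>osc_le\<close>
  finite.\<close>

lemma edge_diff_le:
  fixes f :: "'a \<Rightarrow> real"
  assumes "Gam E f f x \<le> D / 2" "E x y"
  shows "\<bar>f y - f x\<bar> \<le> D"
proof -
  have "(f y - f x)\<^sup>2 \<le> (\<Sum>y\<in>nbrs E x. (f y - f x)\<^sup>2)"
    using assms(2) by (intro member_le_sum) auto
  also have "\<dots> \<le> D" using assms(1) by (simp add: Gam_self)
  also have "\<dots> \<le> (real D)\<^sup>2" using D_pos by (simp add: power2_eq_square)
  finally show ?thesis by (simp add: abs_le_square_iff[symmetric])
qed

lemma lap_bounds:
  assumes "Gam E f f x \<le> D / 2"
  shows "\<bar>lap E f x\<bar> \<le> D"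
proof -
  have "(lap E f x)\<^sup>2 \<le> 2 * real (card (nbrs E x)) * Gam E f f x" by (rule lap_square_le)
  also have "\<dots> \<le> 2 * real D * (D / 2)"
    using assms deg_le[of x] by (intro mult_mono) (auto simp: Gam_nonneg)
  also have "\<dots> = (real D)\<^sup>2" by (simp add: power2_eq_square)
  finally show ?thesis by (simp add: abs_le_square_iff[symmetric])
qed

text \<open>The resolvent \<open>g = (1 - \<Delta>)\<^sup>-\<^sup>1 f\<close>, rescaled by \<open>1 + K\<close>, takes over the role of the heat semigroup.\<close>

lemma rescaled_resolvent:
  assumes "\<And>x. Gam E f f x \<le> D / 2"
  obtains h where "\<And>x. h x - lap E h x = (1 + K) * f x"
    and "\<And>x. Gam E h h x \<le> D / 2"
    and "\<And>x. Gam E h h x + Gam E (\<lambda>z. f z + (-1) * h z) (\<lambda>z. f z + (-1) * h z) x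
        \<le> Gam E f f x + lap E (Gam E h h) x / (1 + K)"
proof -
  obtain g where g: "\<And>x. g x - lap E g x = f x" by (rule resolvent_ex[of E f]) blast
  define h where "h = (\<lambda>z. 0 + (1 + K) * g z)"
  have Gh: "Gam E h h = (\<lambda>x. (1 + K)\<^sup>2 * Gam E g g x)"
    unfolding h_def by (rule ext) (rule Gam_affine)
  have fh: "(\<lambda>z. f z + (-1) * h z) = (\<lambda>z. f z + (- (1 + K)) * g z)"
    by (auto simp: h_def algebra_simps)
  have key: "Gam E h h x + Gam E (\<lambda>z. f z + (-1) * h z) (\<lambda>z. f z + (-1) * h z) x
        \<le> Gam E f f x + lap E (Gam E h h) x / (1 + K)" for x
    using resolvent_Gam[OF CD g K_pos, of x] K_pos unfolding fh Gh lap_mult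
    by (simp add: power2_eq_square)
  obtain p where p: "\<And>x. Gam E h h x \<le> Gam E h h p" using ex_maximum by blast
  have "lap E (Gam E h h) p / (1 + K) \<le> 0"
    using lap_le_0_at_maximum[of "Gam E h h" p E] p K_pos by (simp add: divide_le_0_iff)
  then have "Gam E h h p \<le> D / 2"
    using key[of p] assms[of p] Gam_nonneg[of E "\<lambda>z. f z + (-1) * h z" p] by linarith
  then have "Gam E h h x \<le> D / 2" for x using p[of x] by linarith
  note bound = this
  have "h x - lap E h x = (1 + K) * f x" for x
    using g[of x] unfolding h_def lap_affine by (simp add: right_diff_distrib[symmetric])
  then show ?thesis by (rule that[OF _ bound key])
qed

text \<open>Let s be the supremum of \<open>f y - f x\<close> over all admissible \<open>f\<close>.
  The resolvent equation expresses \<open>(1 + K) * (f y - f x)\<close> by the oscillation of the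
  admissible \<open>h\<close>, at most s, and two Laplacians, at most \<open>D\<close> each. Hence
  (1 + K) s \<le> s + 2 D, that is, s \<le> 2 D / K.\<close>

lemma osc_le:
  fixes f :: "'a \<Rightarrow> real"
  assumes "\<And>x. Gam E f f x \<le> D / 2"
  shows "f y - f x \<le> 2 * D / K"
proof -
  define S where "S = {f y - f x |f :: 'a \<Rightarrow> real. \<forall>x. Gam E f f x \<le> D / 2}"
  have "f y - f x \<le> gdist E x y * D" if "\<forall>x. Gam E f f x \<le> D / 2" for f :: "'a \<Rightarrow> real"
    using gdist_lipschitz[OF conn, of f D y x] edge_diff_le that by fastforce
  then have bdd: "bdd_above S" unfolding S_def by (intro bdd_aboveI) blast
  have ne: "S \<noteq> {}" using assms by (auto simp: S_def)
  have le: "f y - f x \<le> (Sup S + 2 * D) / (1 + K)" if f: "\<forall>x. Gam E f f x \<le> D / 2" for f :: "'a \<Rightarrow> real"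
  proof -
    obtain h where h: "\<And>x. h x - lap E h x = (1 + K) * f x" "\<And>x. Gam E h h x \<le> D / 2"
      by (rule rescaled_resolvent[of f]) (use f in blast)+
    have "h y - h x \<le> Sup S"
      by (rule cSup_upper[OF _ bdd]) (use h(2) in \<open>auto simp: S_def\<close>)
    moreover have "(1 + K) * (f y - f x) = h y - h x - lap E h y + lap E h x"
      using h(1)[of x] h(1)[of y] by (simp add: algebra_simps)
    ultimately have "(1 + K) * (f y - f x) \<le> Sup S + 2 * D"
      using lap_bounds[OF h(2)[of x]] lap_bounds[OF h(2)[of y]] by linarith
    then show ?thesis using K_pos by (simp add: field_simps)
  qed
  have "Sup S \<le> (Sup S + 2 * D) / (1 + K)"
    by (rule cSup_least[OF ne]) (use le in \<open>auto simp: S_def\<close>)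
  then have "Sup S \<le> 2 * D / K" using K_pos by (simp add: field_simps)
  moreover have "f y - f x \<le> Sup S"
    by (rule cSup_upper[OF _ bdd]) (use assms in \<open>auto simp: S_def\<close>)
  ultimately show ?thesis by linarith
qed

text \<open>Every estimate behind \<open>osc_le\<close> must be sharp. This first yields \<Gamma> h
  = D / 2 at \<open>x\<close>, then everywhere by the strong maximum principle. No room is left for
  \<Gamma>(f - h), so \<open>f - h\<close> is constant and the resolvent equation becomes an
  eigenvalue equation.\<close>

lemma osc_rigidity:
  fixes f :: "'a \<Rightarrow> real"
  assumes f: "\<And>x. Gam E f f x \<le> D / 2" and eq: "f y - f x = 2 * D / K"
  obtains c where "\<And>z. lap E f z = c - K * f z" and "\<And>z. Gam E f f z = D / 2"
proof -
  obtain h where h: "\<And>x. h x - lap E h x = (1 + K) * f x" "\<And>x. Gam E h h x \<le> D / 2"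
    "\<And>x. Gam E h h x + Gam E (\<lambda>z. f z + (-1) * h z) (\<lambda>z. f z + (-1) * h z) x
        \<le> Gam E f f x + lap E (Gam E h h) x / (1 + K)"
    by (rule rescaled_resolvent[OF f]) blast
  have "(1 + K) * (f y - f x) = h y - h x - lap E h y + lap E h x"
    using h(1)[of x] h(1)[of y] by (simp add: algebra_simps)
  moreover have "(1 + K) * (f y - f x) = 2 * D / K + 2 * D"
    using eq K_pos by (simp add: field_simps)
  \<comment> \<open>Of the total \<open>2 * D / K + 2 * D\<close>, the oscillation of
    \<open>h\<close> supplies at most \<open>2 * D / K\<close> and \<open>- lap E h y\<close> at
    most \<open>D\<close>.\<close>
  ultimately have "lap E h x \<ge> D"
    using osc_le[OF h(2), of y x] lap_bounds[OF h(2)[of y]] by linarith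
  then have "(real D)\<^sup>2 \<le> (lap E h x)\<^sup>2" by (intro power_mono) auto
  also have "\<dots> \<le> 2 * real (card (nbrs E x)) * Gam E h h x" by (rule lap_square_le)
  also have "\<dots> \<le> 2 * real D * Gam E h h x"
    using deg_le[of x] by (intro mult_right_mono) (auto simp: Gam_nonneg)
  finally have "Gam E h h x \<ge> D / 2" using D_pos by (simp add: power2_eq_square)
  then have start: "Gam E h h x = D / 2" using h(2)[of x] by linarith
  \<comment> \<open>Where \<Gamma> h takes its largest possible value, the resolvent inequality
    leaves no room for a negative Laplacian of \<Gamma> h.\<close>
  have lap_ge: "lap E (Gam E h h) z \<ge> 0" if "Gam E h h z = D / 2" for z
  proof -
    have "lap E (Gam E h h) z / (1 + K) \<ge> 0"
      using h(3)[of z] f[of z] that Gam_nonneg[of E "\<lambda>z. f z + (-1) * h z" z] by linarith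
    then show ?thesis using K_pos by (simp add: zero_le_divide_iff)
  qed
  have Gh: "Gam E h h z = D / 2" for z
  proof (rule connected_graph_induct[OF conn, where P = "\<lambda>z. Gam E h h z = D / 2", OF start])
    fix u v assume u: "Gam E h h u = D / 2" and uv: "E u v"
    have "Gam E h h v = Gam E h h u"
      by (rule maximum_nbr_eq[OF _ lap_ge[OF u] uv]) (unfold u, rule h(2))
    then show "Gam E h h v = D / 2" by (simp only: u)
  qed
  have lGh: "lap E (Gam E h h) z = 0" for z
    unfolding lap_def by (simp only: Gh diff_self sum.neutral_const)
  have *: "D / 2 + Gam E (\<lambda>z. f z + (-1) * h z) (\<lambda>z. f z + (-1) * h z) z \<le> Gam E f f z" for z
    using h(3)[of z] by (simp add: Gh lGh)
  have Gf: "Gam E f f z = D / 2" for z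
    using *[of z] f[of z] Gam_nonneg[of E "\<lambda>z. f z + (-1) * h z" z] by linarith
  have "Gam E (\<lambda>z. f z + (-1) * h z) (\<lambda>z. f z + (-1) * h z) z = 0" for z
    using *[of z] Gf[of z] Gam_nonneg[of E "\<lambda>z. f z + (-1) * h z" z] by linarith
  then have const: "f z + (-1) * h z = f x + (-1) * h x" for z
    by (rule Gam_zero_const[OF conn])
  define c where "c = f x - h x"
  have fh: "f = (\<lambda>z. c + 1 * h z)"
  proof
    show "f z = c + 1 * h z" for z using const[of z] by (simp add: c_def)
  qed
  have "lap E f z = (- c) - K * f z" for z
  proof -
    have "lap E f z = lap E h z" unfolding fh lap_affine by simp
    also have "\<dots> = h z - (1 + K) * f z" using h(1)[of z] by simp
    also have "h z = f z - c" by (simp add: fh)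
    finally show ?thesis by (simp add: algebra_simps)
  qed
  then show ?thesis by (rule that[OF _ Gf])
qed

text \<open>Distances change by at most 1 along an edge and there are at most \<open>D\<close> edges
  at a vertex, so distance functions are admissible for \<open>osc_le\<close>.\<close>

lemma gdist_Gam_le: "Gam E (\<lambda>z. real (gdist E x z)) (\<lambda>z. real (gdist E x z)) y \<le> D / 2"
  and gdist_edge: "E y z \<Longrightarrow> \<bar>real (gdist E x z) - real (gdist E x y)\<bar> \<le> 1"
proof -
  show *: "\<bar>real (gdist E x z) - real (gdist E x y)\<bar> \<le> 1" if "E y z" for y z
    using gdist_nbr_le[OF conn that, of x] gdist_nbr_le[OF conn symE[OF that], of x] by linarith
  have "(\<Sum>z\<in>nbrs E y. (real (gdist E x z) - real (gdist E x y))\<^sup>2) \<le> (\<Sum>z\<in>nbrs E y. 1)"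
    using * by (intro sum_mono) (auto simp: abs_square_le_1)
  then show "Gam E (\<lambda>z. real (gdist E x z)) (\<lambda>z. real (gdist E x z)) y \<le> D / 2"
    using deg_le[of y] by (simp add: Gam_self)
qed

lemma gdist_le_bound: "real (gdist E x y) \<le> 2 * D / K"
  using osc_le[OF gdist_Gam_le[of x], of y x] by simp

lemma diam_le_bound: "real (diam E) \<le> 2 * D / K"
  proof -
  obtain x y where "gdist E x y = diam E" by (rule diam_attained)
  then show ?thesis using gdist_le_bound[of x y] by simp
qed

end

subsection \<open>Test functions at distance two\<close>

definition delta :: "'a \<Rightarrow> 'a \<Rightarrow> real" where
  "delta z = (\<lambda>w. if w = z then 1 else 0)"

lemma lap_delta:
  assumes "y \<noteq> z"
  shows "lap E (delta z) y = (if E y z then 1 else 0)"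
  unfolding lap_def delta_def using assms by simp

text \<open>\<open>delta z\<close> vanishes at \<open>x\<close> and at its neighbours, so
  first-order terms at \<open>x\<close> disappear, and with them \<open>K\<close>. Only paths from
  \<open>x\<close> to \<open>z\<close> of length two remain, each contributing a second difference
  of \<open>f\<close>.\<close>

lemma curv_form_delta:
  assumes "x \<noteq> z" "\<not> E x z"
  shows "curv_form E K f (delta z) x = (\<Sum>y\<in>common_nbrs E x z. f z - 2 * f y + f x) / 4"
proof -
  have vanish: "Gam E h (delta z) x = 0" for h
    unfolding Gam_eq using assms by (auto simp: delta_def intro!: sum.neutral)
  have "Gam E f (delta z) y = (if E y z then (f z - f y) / 2 else 0)" if "E x y" for y
  proof -
    have "(\<Sum>w\<in>nbrs E y. (f w - f y) * (delta z w - delta z y))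
      = (\<Sum>w\<in>nbrs E y. if w = z then f w - f y else 0)"
      using that assms by (intro sum.cong) (auto simp: delta_def)
    then show ?thesis by (simp add: Gam_eq)
  qed
  then have 1: "lap E (Gam E f (delta z)) x = (\<Sum>y\<in>nbrs E x. if E y z then (f z - f y) / 2 else 0)"
    unfolding lap_def vanish by (intro sum.cong) auto
  have "lap E (delta z) y = (if E y z then 1 else 0)" if "E x y" for y
    using that assms by (intro lap_delta) auto
  moreover have "lap E (delta z) x = 0" using lap_delta[of x z E] assms by simp
  ultimately have 2: "Gam E f (lap E (delta z)) x = (\<Sum>y\<in>nbrs E x. if E y z then f y - f x else 0) / 2"
    unfolding Gam_eq by (intro arg_cong2[of _ _ _ _ "(/)"] sum.cong) auto
  have "curv_form E K f (delta z) x
    = (lap E (Gam E f (delta z)) x - Gam E f (lap E (delta z)) x) / 2"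
    by (simp add: curv_form_def Gam2_def vanish Gam_commute[of E "delta z"])
  also have "\<dots> = (\<Sum>y\<in>nbrs E x. if E y z then f z - 2 * f y + f x else 0) / 4"
    unfolding 1 2 sum_divide_distrib sum_subtractf[symmetric]
    by (intro sum.cong) (auto simp: field_simps)
  also have "\<dots> = (\<Sum>y\<in>common_nbrs E x z. f z - 2 * f y + f x) / 4"
    by (simp add: sum.inter_filter[symmetric])
  finally show ?thesis .
qed

text \<open>The kernel property of \<open>f\<close> tested against \<open>delta z\<close>.\<close>

lemma midpoint_sum:
  assumes "CD_inf E K" "Gam2 E f f x = K * Gam E f f x" "x \<noteq> z" "\<not> E x z"
  shows "(\<Sum>y\<in>common_nbrs E x z. f z - 2 * f y + f x) = 0"
  using curv_form_kernel[OF assms(1,2), of "delta z"] curv_form_delta[of x z E K f] assms(3,4) by simp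

lemma curv_form_sum_right:
  assumes "finite Z"
  shows "curv_form E K f (\<lambda>w. g w + (\<Sum>z\<in>Z. c z * h z w)) x
    = curv_form E K f g x + (\<Sum>z\<in>Z. c z * curv_form E K f (h z) x)"
  using assms
proof (induction Z rule: finite_induct)
  case (insert a Z)
  have "(\<lambda>w. g w + (\<Sum>z\<in>insert a Z. c z * h z w)) = (\<lambda>w. (g w + (\<Sum>z\<in>Z. c z * h z w)) + c a * h a w)"
    using insert.hyps by auto
  then show ?case using insert.hyps
    by (simp only: curv_form_add_mult_right insert.IH) simp
qed simp

lemma curv_form_delta_nbr:
  assumes "\<And>x y. E x y \<Longrightarrow> E y x" "\<And>x. \<not> E x x" "\<And>x. card (nbrs E x) = D"
    and triangle_free: "\<And>x y z. E x y \<Longrightarrow> E y z \<Longrightarrow> \<not> E x z" and "E x u"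
  shows "curv_form E K (delta u) (delta u) x = (real D + 1 - K) / 2"
proof -
  have G: "Gam E (delta u) (delta u) y = (if y = u then real D / 2 else if E y u then 1 / 2 else 0)" for y
  proof (cases "y = u")
    case True
    have "(\<Sum>w\<in>nbrs E u. (delta u w - delta u u)\<^sup>2) = (\<Sum>w\<in>nbrs E u. 1)"
      using assms(2)[of u] by (intro sum.cong) (auto simp: delta_def)
    then show ?thesis using True assms(3)[of u] by (simp add: Gam_self)
  next
    case False
    then have "(\<Sum>w\<in>nbrs E y. (delta u w - delta u y)\<^sup>2) = (\<Sum>w\<in>nbrs E y. if w = u then 1 else 0)"
      by (intro sum.cong) (auto simp: delta_def)
    then show ?thesis using False by (simp add: Gam_self)
  qed
  have xu: "x \<noteq> u" using assms(2,5) by auto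
  \<comment> \<open>The neighbour \<open>u\<close> of \<open>x\<close> contributes D/2 - 1/2. The
    other D - 1 neighbours are not adjacent to \<open>u\<close>, as there are no triangles, and
    contribute -1/2 each; everything cancels.\<close>
  have "lap E (Gam E (delta u) (delta u)) x = (\<Sum>y\<in>nbrs E x. (if y = u then real D / 2 else 0) - 1 / 2)"
    unfolding lap_def G using xu assms(5) triangle_free[of x _ u] by (intro sum.cong) auto
  also have "\<dots> = 0"
    using assms(3)[of x] assms(5) by (simp add: sum_subtractf)
  finally have 1: "lap E (Gam E (delta u) (delta u)) x = 0" .
  have "lap E (delta u) u = (\<Sum>y\<in>nbrs E u. - 1)"
    unfolding lap_def using assms(2)[of u] by (intro sum.cong) (auto simp: delta_def)
  then have lu: "lap E (delta u) u = - real D" using assms(3)[of u] by simp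
  have lx: "lap E (delta u) x = 1" using lap_delta[OF xu] assms(5) by simp
  have "Gam E (delta u) (lap E (delta u)) x
    = (\<Sum>y\<in>nbrs E x. if y = u then lap E (delta u) u - lap E (delta u) x else 0) / 2"
    unfolding Gam_eq using xu
    by (intro arg_cong2[of _ _ _ _ "(/)"] sum.cong) (auto simp: delta_def)
  also have "\<dots> = (- real D - 1) / 2" using assms(5) by (simp add: lu lx)
  finally have 2: "Gam E (delta u) (lap E (delta u)) x = (- real D - 1) / 2" .
  show ?thesis unfolding curv_form_def Gam2_def 1 2 G using xu assms(5) by (simp add: field_simps)
qed

text \<open>The curvature bound at \<open>x\<close> is tested on \<open>delta u\<close> corrected at
  the remaining neighbours \<open>z\<close> of \<open>u\<close>, with coefficients that make the
  form as small as possible. Its value is then the difference of the two sides.\<close>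

lemma sum_inverse_common_nbrs_le:
  assumes "\<And>x y. E x y \<Longrightarrow> E y x" "\<And>x. \<not> E x x" "\<And>x. card (nbrs E x) = D"
    and triangle_free: "\<And>x y z. E x y \<Longrightarrow> E y z \<Longrightarrow> \<not> E x z"
    and "CD_inf E 2" "E x u"
  shows "(\<Sum>z\<in>nbrs E u - {x}. 1 / real (card (common_nbrs E x z))) \<le> (real D - 1) / 2"
proof -
  define Z where "Z = nbrs E u - {x}"
  \<comment> \<open>The choice making \<open>\<phi>\<close> orthogonal to each
    \<open>delta z\<close> for the form: the second differences sum to \<open>c z\<close> times the
    number of common neighbours, minus 2 from the one at \<open>u\<close>.\<close>
  define c where "c z = 2 / real (card (common_nbrs E x z))" for z
  define \<phi> where "\<phi> = (\<lambda>w. delta u w + (\<Sum>z\<in>Z. c z * delta z w))"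
  have finZ: "finite Z" by simp
  have xu: "x \<noteq> u" using assms(2,6) by auto
  have Z: "x \<noteq> z" "\<not> E x z" "u \<in> common_nbrs E x z" "u \<noteq> z" if "z \<in> Z" for z
    using that assms(2,6) triangle_free[OF assms(6)] by (auto simp: Z_def)
  have sumZ: "(\<Sum>z\<in>Z. c z * delta z w) = (if w \<in> Z then c w else 0)" for w
  proof -
    have "(\<Sum>z\<in>Z. c z * delta z w) = (\<Sum>z\<in>Z. if w = z then c z else 0)"
      by (intro sum.cong) (auto simp: delta_def)
    then show ?thesis by simp
  qed
  have 1: "curv_form E 2 \<phi> (delta z) x = 0" if z: "z \<in> Z" for z
  proof -
    have "(\<Sum>y\<in>common_nbrs E x z. \<phi> z - 2 * \<phi> y + \<phi> x)
      = (\<Sum>y\<in>common_nbrs E x z. c z - (if y = u then 2 else 0))"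
      unfolding \<phi>_def sumZ using Z z xu by (intro sum.cong) (auto simp: delta_def)
    also have "\<dots> = 0"
    proof -
      have "card (common_nbrs E x z) \<noteq> 0" using Z(3)[OF z] by auto
      then show ?thesis using Z(3)[OF z] by (simp add: sum_subtractf c_def)
    qed
    finally show ?thesis using curv_form_delta[of x z E 2 \<phi>] Z[OF z] by simp
  qed
  have 2: "curv_form E 2 (delta u) (delta z) x = - 1 / 2" if z: "z \<in> Z" for z
  proof -
    have "(\<Sum>y\<in>common_nbrs E x z. delta u z - 2 * delta u y + delta u x)
      = (\<Sum>y\<in>common_nbrs E x z. if y = u then - 2 else 0)"
      using Z[OF z] xu by (intro sum.cong) (auto simp: delta_def)
    also have "\<dots> = - 2" using Z(3)[OF z] by simp
    finally show ?thesis using curv_form_delta[of x z E 2 "delta u"] Z[OF z] by simp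
  qed
  have "0 \<le> curv_form E 2 \<phi> \<phi> x" by (rule CD_inf_curv_form[OF assms(5)])
  \<comment> \<open>By this orthogonality only the component \<open>delta u\<close> of one argument
    survives.\<close>
  also have "\<dots> = curv_form E 2 \<phi> (delta u) x"
    by (subst (2) \<phi>_def) (simp only: curv_form_sum_right[OF finZ] 1 mult_zero_right sum.neutral_const add_0_right cong: sum.cong)
  also have "\<dots> = curv_form E 2 (delta u) \<phi> x" by (rule curv_form_commute)
  also have "\<dots> = (real D - 1) / 2 + (\<Sum>z\<in>Z. c z * (- 1 / 2))"
    using curv_form_delta_nbr[OF assms(1-4,6), where K = 2] 2
    by (simp add: \<phi>_def curv_form_sum_right[OF finZ] cong: sum.cong)
  also have "\<dots> = (real D - 1) / 2 - (\<Sum>z\<in>Z. 1 / real (card (common_nbrs E x z)))"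
    by (simp add: c_def sum_negf)
  finally show ?thesis by (simp add: Z_def)
qed

subsection \<open>Level structure and the hypercube\<close>

text \<open>The combinatorial content of the rigid distance function \<open>l\<close> from
  \<open>r\<close>. The curvature bound survives in \<open>updown\<close>, which comes from the
  kernel of the form, and in \<open>inverse_sum\<close>, which comes from test functions at distance
  two.\<close>

locale levelled_graph =
  fixes E :: "'a::finite \<Rightarrow> 'a \<Rightarrow> bool" and l :: "'a \<Rightarrow> nat" and D :: nat and r t :: 'a
  assumes symE: "E x y \<Longrightarrow> E y x"
    and level_edge: "E x y \<Longrightarrow> l y = Suc (l x) \<or> l x = Suc (l y)"
    and card_down: "card {y. E x y \<and> l x = Suc (l y)} = l x"
    and regular: "card (nbrs E x) = D"
    and updown: "l x = l z \<Longrightarrow> x \<noteq> z \<Longrightarrow>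
      card {y \<in> common_nbrs E x z. l y = Suc (l x)} = card {y \<in> common_nbrs E x z. l x = Suc (l y)}"
    and inverse_sum: "E x u \<Longrightarrow>
      (\<Sum>z\<in>nbrs E u - {x}. 1 / real (card (common_nbrs E x z))) \<le> (real D - 1) / 2"
    and root: "l x = 0 \<longleftrightarrow> x = r"
    and top: "l t = D"
begin

definition up :: "'a \<Rightarrow> 'a set" where "up x = {y. E x y \<and> l y = Suc (l x)}"
definition down :: "'a \<Rightarrow> 'a set" where "down x = {y. E x y \<and> l x = Suc (l y)}"

lemma up_iff_down: "y \<in> up x \<longleftrightarrow> x \<in> down y"
  using symE by (auto simp: up_def down_def)

lemma card_down': "card (down x) = l x"
  by (simp add: down_def card_down)

lemma nbrs_up_down: "nbrs E x = up x \<union> down x" "up x \<inter> down x = {}"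
  unfolding up_def down_def using level_edge by (blast, auto)

lemma card_up: "card (up x) = D - l x" and level_le: "l x \<le> D"
proof -
  have "card (up x) + card (down x) = D"
    using card_Un_disjoint[of "up x" "down x"] nbrs_up_down[of x] regular[of x] by simp
  then show "card (up x) = D - l x" "l x \<le> D" using card_down'[of x] by auto
qed

lemma level_up: "y \<in> up x \<Longrightarrow> l y = Suc (l x)" and level_down: "y \<in> down x \<Longrightarrow> l x = Suc (l y)"
  by (auto simp: up_def down_def)

lemma card_up_Int: "l x = l z \<Longrightarrow> x \<noteq> z \<Longrightarrow> card (up x \<inter> up z) = card (down x \<inter> down z)"
proof -
  assume *: "l x = l z" "x \<noteq> z"
  have "up x \<inter> up z = {y \<in> common_nbrs E x z. l y = Suc (l x)}"
    "down x \<inter> down z = {y \<in> common_nbrs E x z. l x = Suc (l y)}"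
    using * symE by (auto simp: up_def down_def)
  then show ?thesis using updown[OF *] by simp
qed

text \<open>Two common lower neighbours of \<open>x\<close> and \<open>z\<close> have \<open>x\<close> and \<open>z\<close> as common upper neighbours,
  hence also two common lower neighbours.\<close>

lemma card_down_Int_le: "l x = l z \<Longrightarrow> x \<noteq> z \<Longrightarrow> card (down x \<inter> down z) \<le> 1"
proof (induction "l x" arbitrary: x z)
  case 0
  then show ?case using card_down'[of x] by simp
next
  case (Suc k)
  show ?case
  proof (rule ccontr)
    assume "\<not> card (down x \<inter> down z) \<le> 1"
    then obtain u v where uv: "u \<in> down x \<inter> down z" "v \<in> down x \<inter> down z" "u \<noteq> v"
      by (metis card_le_Suc0_iff_eq finite One_nat_def)
    have l: "l u = l v" "k = l u"
      using uv(1,2) Suc.hyps(2) level_down[of u x] level_down[of v x] by simp_all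
    have "{x, z} \<subseteq> up u \<inter> up v" using uv up_iff_down by auto
    then have "card {x, z} \<le> card (up u \<inter> up v)" by (intro card_mono) auto
    also have "\<dots> \<le> 1" using card_up_Int[OF l(1) uv(3)] Suc.hyps(1)[OF l(2,1) uv(3)] by simp
    finally show False using Suc.prems by simp
  qed
qed

text \<open>The common lower neighbour \<open>x\<close> is the only one, and \<open>updown\<close>
  transfers the count to upper neighbours. \<open>card_down_Int_eq_1\<close> argues dually from a
  common upper neighbour.\<close>

lemma card_up_Int_eq_1:
  assumes "x \<in> down u" "x \<in> down v" "u \<noteq> v"
  shows "card (up u \<inter> up v) = 1" "card (down u \<inter> down v) = 1"
proof -
  have l: "l u = l v" using level_down[OF assms(1)] level_down[OF assms(2)] by simp
  have "card (down u \<inter> down v) > 0" using assms by (auto simp: card_gt_0_iff)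
  then show "card (down u \<inter> down v) = 1" using card_down_Int_le[OF l assms(3)] by linarith
  then show "card (up u \<inter> up v) = 1" using card_up_Int[OF l assms(3)] by simp
qed

lemma card_down_Int_eq_1:
  assumes "u \<in> down x" "v \<in> down x" "u \<noteq> v"
  shows "card (down u \<inter> down v) = 1"
proof -
  have l: "l u = l v" using level_down[OF assms(1)] level_down[OF assms(2)] by simp
  have "x \<in> up u \<inter> up v" using assms up_iff_down by auto
  then have "card (up u \<inter> up v) > 0" by (auto simp: card_gt_0_iff)
  then show ?thesis using card_up_Int[OF l assms(3)] card_down_Int_le[OF l assms(3)] by linarith
qed

text \<open>\<open>inverse_sum\<close> is applied to the edge from \<open>x\<close> to
  \<open>u\<close>. Each \<open>z\<close> below \<open>u\<close> other than \<open>x\<close> has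
  exactly two common neighbours with \<open>x\<close>, one above and one below. For the
  \<open>n\<close> vertices \<open>z\<close> above \<open>u\<close>, double counting shows that the
  numbers \<open>d z\<close> have mean 2, while their inverses sum to at most n/2; by convexity each
  is 2.\<close>

lemma card_between:
  assumes u: "u \<in> up x" and w: "w \<in> up u"
  shows "card (common_nbrs E x w) = 2"
proof -
  define d where "d z = real (card (common_nbrs E x z))" for z
  define n where "n = D - Suc (l x)"
  have xu: "x \<in> down u" using u up_iff_down by simp
  have lu: "l u = Suc (l x)" using u level_up by simp
  have Exu: "E x u" using u by (simp add: up_def)
  have split: "nbrs E u - {x} = up u \<union> (down u - {x})" "up u \<inter> (down u - {x}) = {}"
    using nbrs_up_down[of u] xu lu level_up[of x u] by auto
  have n: "card (up u) = n" "real n = real D - 1 - real (l x)"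
    using card_up[of u] level_le[of u] lu by (auto simp: n_def)
  have d_down: "d z = 2" if z: "z \<in> down u - {x}" for z
  proof -
    have lz: "l x = l z" "x \<noteq> z" using z lu level_down[of z u] by auto
    have "common_nbrs E x z = (up x \<inter> up z) \<union> (down x \<inter> down z)"
      using lz symE level_edge by (auto simp: up_def down_def)
    moreover have "(up x \<inter> up z) \<inter> (down x \<inter> down z) = {}" using nbrs_up_down[of x] by auto
    ultimately have "card (common_nbrs E x z) = card (up x \<inter> up z) + card (down x \<inter> down z)"
      by (simp add: card_Un_disjoint)
    moreover have "u \<in> up x \<inter> up z" using u z up_iff_down by auto
    then have "card (up x \<inter> up z) > 0" by (auto simp: card_gt_0_iff)
    ultimately have "card (common_nbrs E x z) = 2"
      using card_up_Int[OF lz] card_down_Int_le[OF lz] by linarith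
    then show ?thesis by (simp add: d_def)
  qed
  have between: "common_nbrs E x z = insert u {v \<in> up x - {u}. z \<in> up v}" if z: "z \<in> up u" for z
  proof -
    have lz: "l z = Suc (Suc (l x))" using level_up[OF z] lu by simp
    have "y \<in> common_nbrs E x z \<longleftrightarrow> y \<in> up x \<and> z \<in> up y" for y
    proof
      assume "y \<in> common_nbrs E x z"
      then have e: "E x y" "E y z" by auto
      have "l y = Suc (l x)" using level_edge[OF e(1)] level_edge[OF e(2)] lz by linarith
      with e lz show "y \<in> up x \<and> z \<in> up y" by (simp add: up_def)
    qed (auto simp: up_def)
    then show ?thesis using u z by blast
  qed
  \<comment> \<open>Double counting: besides \<open>u\<close>, the midpoints between
    \<open>x\<close> and \<open>z\<close> are the other upper neighbours \<open>v\<close> of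
    \<open>x\<close> below \<open>z\<close>, and each such \<open>v\<close> shares exactly one upper
    neighbour with \<open>u\<close>.\<close>
  have "(\<Sum>z\<in>up u. d z) = (\<Sum>z\<in>up u. 1 + (\<Sum>v\<in>up x - {u}. if z \<in> up v then 1 else 0))"
  proof (rule sum.cong)
    fix z assume z: "z \<in> up u"
    have "{v \<in> up x - {u}. z \<in> up v} = (up x - {u}) \<inter> {v. z \<in> up v}" by auto
    then have "d z = 1 + real (card ((up x - {u}) \<inter> {v. z \<in> up v}))"
      unfolding d_def between[OF z] by simp
    then show "d z = 1 + (\<Sum>v\<in>up x - {u}. if z \<in> up v then 1 else 0)"
      by (simp add: sum.If_cases)
  qed simp
  also have "\<dots> = real n + (\<Sum>v\<in>up x - {u}. \<Sum>z\<in>up u. if z \<in> up v then 1 else 0)"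
    unfolding sum.distrib using n(1) by (simp, subst sum.swap, simp)
  also have "(\<Sum>v\<in>up x - {u}. \<Sum>z\<in>up u. if z \<in> up v then 1 else 0) = (\<Sum>v\<in>up x - {u}. 1::real)"
  proof (rule sum.cong)
    fix v assume v: "v \<in> up x - {u}"
    have "card (up u \<inter> up v) = 1"
      using v u up_iff_down by (intro card_up_Int_eq_1[of x]) auto
    moreover have "up u \<inter> {z. z \<in> up v} = up u \<inter> up v" by auto
    ultimately show "(\<Sum>z\<in>up u. if z \<in> up v then 1 else 0) = (1::real)"
      by (simp add: sum.If_cases)
  qed simp
  also have "\<dots> = real n" using card_up[of x] u by (simp add: n_def)
  finally have sum_d: "(\<Sum>z\<in>up u. d z) = 2 * real n" by simp
  have "(\<Sum>z\<in>nbrs E u - {x}. 1 / d z) = (\<Sum>z\<in>up u. 1 / d z) + (\<Sum>z\<in>down u - {x}. 1 / d z)"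
    unfolding split(1) by (rule sum.union_disjoint) (use split(2) in auto)
  also have "(\<Sum>z\<in>down u - {x}. 1 / d z) = real (l x) / 2"
    using d_down card_down'[of u] xu lu by simp
  finally have le: "(\<Sum>z\<in>up u. 1 / d z) \<le> real n / 2"
    using inverse_sum[OF Exu] n(2) by (simp add: d_def)
  \<comment> \<open>\<open>1 / d \<ge> 1 - d / 4\<close> with equality only for \<open>d = 2\<close>, while the \<open>n\<close> numbers \<open>d z\<close> add up to \<open>2 n\<close>.\<close>
  have d_pos: "d z > 0" if "z \<in> up u" for z
    unfolding d_def between[OF that] by (simp add: card_gt_0_iff)
  have amgm: "1 / d z - (1 - d z / 4) \<ge> 0" if "z \<in> up u" for z
  proof -
    have "1 / d z - (1 - d z / 4) = (d z - 2)\<^sup>2 / (4 * d z)"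
      using d_pos[OF that] by (simp add: field_simps power2_eq_square)
    then show ?thesis using d_pos[OF that] by simp
  qed
  have "(\<Sum>z\<in>up u. 1 / d z - (1 - d z / 4)) = (\<Sum>z\<in>up u. 1 / d z) - real n + (\<Sum>z\<in>up u. d z) / 4"
    using n(1) by (simp add: sum_subtractf sum_divide_distrib)
  then have "(\<Sum>z\<in>up u. 1 / d z - (1 - d z / 4)) \<le> 0"
    using le sum_d by simp
  then have "(\<Sum>z\<in>up u. 1 / d z - (1 - d z / 4)) = 0"
    using amgm by (intro order_antisym sum_nonneg) auto
  then have "1 / d w - (1 - d w / 4) = 0"
    using amgm w by (subst (asm) sum_nonneg_eq_0_iff) auto
  then have "(d w - 2)\<^sup>2 = 0" using d_pos[OF w] by (simp add: field_simps power2_eq_square)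
  then show ?thesis by (simp add: d_def)
qed

section \<open>Atoms and the cubical structure\<close>

inductive below :: "'a \<Rightarrow> 'a \<Rightarrow> bool" where
  atom: "l a = 1 \<Longrightarrow> below a a"
| step: "below a x \<Longrightarrow> y \<in> up x \<Longrightarrow> below a y"

text \<open>The atoms are the vertices of level 1, and \<open>below\<close> records ascending paths
  from them. The set \<open>atoms x\<close> will be the vertex of the cube that corresponds to
  \<open>x\<close>.\<close>

definition atoms :: "'a \<Rightarrow> 'a set" where "atoms x = {a. below a x}"

lemma below_level: "below a x \<Longrightarrow> l a = 1 \<and> 1 \<le> l x"
  by (induction rule: below.induct) (auto simp: level_up)

lemma atoms_root: "atoms r = {}"
  using below_level[of _ r] root[of r] by (auto simp: atoms_def)

lemma atoms_atom: "l a = 1 \<Longrightarrow> atoms a = {a}"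
proof -
  assume a: "l a = 1"
  have "b = a" if "below b a" for b
    using that
  proof cases
    case (step x)
    then show ?thesis using below_level[of b x] level_up[of a x] a by simp
  qed simp
  then show ?thesis using a below.atom by (auto simp: atoms_def)
qed

lemma atoms_step: "l x \<ge> 2 \<Longrightarrow> atoms x = (\<Union>y\<in>down x. atoms y)"
proof -
  assume x: "l x \<ge> 2"
  have "\<exists>y\<in>down x. below a y" if "below a x" for a
    using that
  proof cases
    case (step y)
    then show ?thesis using up_iff_down by auto
  qed (use x in auto)
  then show ?thesis using below.step up_iff_down by (auto simp: atoms_def)
qed

definition cubical :: "'a \<Rightarrow> bool" where
  "cubical x \<longleftrightarrow> card (atoms x) = l x \<and> atoms ` down x = (\<lambda>i. atoms x - {i}) ` atoms x"

text \<open>Both statements are proved in one induction on the level. For \<open>x\<close> one level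
  up, fix a lower neighbour \<open>p\<close>; every other lower neighbour \<open>q\<close> shares a
  single lower neighbour \<open>m q\<close> with \<open>p\<close>, so \<open>atoms q\<close> arises
  from \<open>atoms p\<close> by exchanging \<open>i q\<close> for \<open>a q\<close>. The
  \<open>i q\<close> run through \<open>atoms p\<close> once each and the \<open>a q\<close> all
  coincide, so \<open>x\<close> has the atoms of \<open>p\<close> and one more. Injectivity follows
  since two vertices with equal atoms would share at least two lower neighbours.\<close>

lemma cubical_inj: "(\<forall>x. l x = k \<longrightarrow> cubical x) \<and> (\<forall>x y. l x = k \<longrightarrow> l y = k \<longrightarrow> atoms x = atoms y \<longrightarrow> x = y)"
proof (induction k)
  case 0
  have "down r = {}" using card_down'[of r] root[of r] by simp
  then show ?case using root atoms_root root by (auto simp: cubical_def)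
next
  case (Suc k)
  have IHc: "card (atoms x) = k" "atoms ` down x = (\<lambda>i. atoms x - {i}) ` atoms x" if "l x = k" for x
    using Suc that by (auto simp: cubical_def)
  have IHi: "x = y" if "l x = k" "l y = k" "atoms x = atoms y" for x y
    using Suc that by blast
  show ?case
  \<comment> \<open>Level 1 is separate: the only lower neighbour is \<open>r\<close>, and
    \<open>atoms_step\<close> starts at level 2.\<close>
  proof (cases "k = 0")
    case True
    have "down x = {r}" if "l x = 1" for x
    proof -
      have "down x \<subseteq> {r}" using level_down[of _ x] that root by auto
      moreover have "down x \<noteq> {}" using card_down'[of x] that by auto
      ultimately show ?thesis by auto
    qed
    then show ?thesis using True atoms_atom atoms_root by (auto simp: cubical_def)
  next
    case False
    have main: "cubical x" if x: "l x = Suc k" for x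
    proof -
      have lev: "l y = k" if "y \<in> down x" for y using level_down[OF that] x by simp
      have "down x \<noteq> {}" using card_down'[of x] x by auto
      then obtain p where p: "p \<in> down x" by auto
      have xp: "x \<in> up p" using p up_iff_down by simp
      define Q where "Q = down x - {p}"
      have cardQ: "card Q = k" using card_down'[of x] x p by (simp add: Q_def)
      have cp: "card (atoms p) = k" by (rule IHc(1)[OF lev[OF p]])
      have levQ: "l q = k" if "q \<in> Q" for q using that lev by (simp add: Q_def)
      have "\<exists>z. down p \<inter> down q = {z}" if "q \<in> Q" for q
        using card_down_Int_eq_1[of p x q] p that by (auto simp: Q_def intro: card_1_singletonE)
      then obtain m where m: "\<And>q. q \<in> Q \<Longrightarrow> down p \<inter> down q = {m q}" by metis
      \<comment> \<open>If \<open>m q = m q'\<close>, then \<open>p\<close>, \<open>q\<close> and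
        \<open>q'\<close> would be three vertices between it and \<open>x\<close>, where
        \<open>card_between\<close> allows two.\<close>
      have inj_m: "q = q'" if q: "q \<in> Q" "q' \<in> Q" "m q = m q'" for q q'
      proof (rule ccontr)
        assume "q \<noteq> q'"
        define z where "z = m q"
        have z: "z \<in> down p" "z \<in> down q" "z \<in> down q'"
          using m[OF q(1)] m[OF q(2)] q(3) by (auto simp: z_def)
        have "{p, q, q'} \<subseteq> common_nbrs E z x"
          using z p q symE by (auto simp: down_def Q_def)
        then have "card {p, q, q'} \<le> card (common_nbrs E z x)" by (intro card_mono) auto
        moreover have "card (common_nbrs E z x) = 2"
          by (rule card_between[of p z x]) (use z(1) xp up_iff_down in auto)
        ultimately show False using q \<open>q \<noteq> q'\<close> by (auto simp: Q_def)
      qed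
      have inj_atoms: "inj_on atoms (down p)"
      proof (rule eq_card_imp_inj_on)
        have "inj_on (\<lambda>i. atoms p - {i}) (atoms p)" by (rule inj_onI) blast
        then show "card (atoms ` down p) = card (down p)"
          unfolding IHc(2)[OF lev[OF p]] by (simp add: card_image cp card_down' lev[OF p])
      qed simp
      have shape: "\<exists>i a. i \<in> atoms p \<and> a \<notin> atoms p \<and> atoms q = insert a (atoms p - {i}) \<and> atoms (m q) = atoms p - {i}"
        if q: "q \<in> Q" for q
      proof -
        have mq: "m q \<in> down p" "m q \<in> down q" using m[OF q] by auto
        obtain i where i: "i \<in> atoms p" "atoms (m q) = atoms p - {i}"
          using IHc(2)[OF lev[OF p]] mq(1) by blast
        obtain a where a: "a \<in> atoms q" "atoms (m q) = atoms q - {a}"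
          using IHc(2)[OF levQ[OF q]] mq(2) by blast
        \<comment> \<open>Otherwise \<open>a = i\<close>, so \<open>q\<close> and \<open>p\<close>
          would have the same atoms and coincide by the induction hypothesis.\<close>
        have "a \<notin> atoms p"
        proof
          assume "a \<in> atoms p"
          moreover have "a \<notin> atoms p - {i}" using i a by blast
          ultimately have "a = i" by blast
          then have "atoms q = atoms p" using i a by blast
          then show False using IHi[OF levQ[OF q] lev[OF p]] q by (simp add: Q_def)
        qed
        then show ?thesis using i a by blast
      qed
      obtain i a where i: "\<And>q. q \<in> Q \<Longrightarrow> i q \<in> atoms p" and a: "\<And>q. q \<in> Q \<Longrightarrow> a q \<notin> atoms p"
        and at: "\<And>q. q \<in> Q \<Longrightarrow> atoms q = insert (a q) (atoms p - {i q})"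
        and atm: "\<And>q. q \<in> Q \<Longrightarrow> atoms (m q) = atoms p - {i q}"
      proof -
        have "\<exists>ia. \<forall>q\<in>Q. fst (ia q) \<in> atoms p \<and> snd (ia q) \<notin> atoms p \<and>
          atoms q = insert (snd (ia q)) (atoms p - {fst (ia q)}) \<and> atoms (m q) = atoms p - {fst (ia q)}"
          by (intro bchoice ballI, drule shape) auto
        then show ?thesis using that[of "\<lambda>q. fst (ia q)" "\<lambda>q. snd (ia q)" for ia] by blast
      qed
      have inj_i: "inj_on i Q"
      proof (rule inj_onI)
        fix q q' assume q: "q \<in> Q" "q' \<in> Q" "i q = i q'"
        have "m q \<in> down p" "m q' \<in> down p" using m q by auto
        then have "m q = m q'" using inj_onD[OF inj_atoms, of "m q" "m q'"] atm q by simp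
        then show "q = q'" using inj_m q by blast
      qed
      have im_i: "i ` Q = atoms p"
        by (rule card_subset_eq) (use i card_image[OF inj_i] cardQ cp in auto)
      \<comment> \<open>The common lower neighbour \<open>z\<close> of \<open>q\<close> and
        \<open>q'\<close> has \<open>k - 1\<close> atoms; if \<open>a q\<close> and
        \<open>a q'\<close> differed, they would all lie in \<open>atoms p\<close> without
        \<open>i q\<close> and \<open>i q'\<close>, a set of size \<open>k - 2\<close>.\<close>
      have same: "a q = a q'" if q: "q \<in> Q" "q' \<in> Q" for q q'
      proof (rule ccontr)
        assume ne: "a q \<noteq> a q'"
        then have qq: "q \<noteq> q'" by auto
        then have ii: "i q \<noteq> i q'" using inj_i q by (auto dest: inj_onD)
        have "card (down q \<inter> down q') = 1"
          by (rule card_down_Int_eq_1[of q x q']) (use q qq in \<open>auto simp: Q_def\<close>)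
        then obtain z where "down q \<inter> down q' = {z}" by (rule card_1_singletonE)
        then have z: "z \<in> down q" "z \<in> down q'" by auto
        obtain c where c: "c \<in> atoms q" "atoms z = atoms q - {c}"
          using IHc(2)[OF levQ[OF q(1)]] z(1) by blast
        obtain c' where c': "atoms z = atoms q' - {c'}"
          using IHc(2)[OF levQ[OF q(2)]] z(2) by blast
        have "atoms z \<subseteq> atoms p - {i q, i q'}"
        proof
          fix w assume "w \<in> atoms z"
          moreover have "atoms z \<subseteq> atoms q" unfolding c(2) by (rule Diff_subset)
          moreover have "atoms z \<subseteq> atoms q'" unfolding c' by (rule Diff_subset)
          ultimately have "w \<in> atoms q" "w \<in> atoms q'" by auto
          then have "w = a q \<or> w \<in> atoms p \<and> w \<noteq> i q" "w = a q' \<or> w \<in> atoms p \<and> w \<noteq> i q'"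
            using at[OF q(1)] at[OF q(2)] by simp_all
          then show "w \<in> atoms p - {i q, i q'}"
            using a[OF q(1)] a[OF q(2)] ne by auto
        qed
        then have "card (atoms z) \<le> card (atoms p - {i q, i q'})" by (intro card_mono) auto
        also have "\<dots> = k - 2"
          using i[OF q(1)] i[OF q(2)] ii by (simp add: card_Diff_subset cp)
        finally have "card (atoms z) \<le> k - 2" .
        moreover have "card (atoms z) = k - 1"
          using c IHc(1)[OF levQ[OF q(1)]] by simp
        \<comment> \<open>This gives \<open>k \<ge> 2\<close>, so that the subtraction in
          \<open>k - 2\<close> is not truncated.\<close>
        moreover have "card {i q, i q'} \<le> k"
          unfolding cp[symmetric] using i q by (intro card_mono) auto
        ultimately show False using ii by simp
      qed
      have "Q \<noteq> {}" using cardQ False by auto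
      then obtain q0 where q0: "q0 \<in> Q" by auto
      define b where "b = a q0"
      have b: "b \<notin> atoms p" using a[OF q0] by (simp add: b_def)
      have atQ: "atoms q = insert b (atoms p - {i q})" if "q \<in> Q" for q
        using at[OF that] same[OF that q0] by (simp add: b_def)
      have dx: "down x = insert p Q" using p by (auto simp: Q_def)
      have ax: "atoms x = insert b (atoms p)"
      proof -
        have "(\<Union>q\<in>Q. atoms q) \<subseteq> insert b (atoms p)" "b \<in> (\<Union>q\<in>Q. atoms q)"
          using atQ q0 by blast+
        moreover have "atoms x = atoms p \<union> (\<Union>q\<in>Q. atoms q)"
          using atoms_step[of x] x False unfolding dx by simp
        ultimately show ?thesis by blast
      qed
      \<comment> \<open>Removing \<open>i q\<close> from \<open>atoms x\<close> leaves
        \<open>atoms q\<close>, and removing \<open>b\<close> leaves \<open>atoms p\<close>.\<close>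
      have "atoms ` Q = (\<lambda>j. insert b (atoms p - {j})) ` i ` Q"
        unfolding image_image by (rule image_cong[OF refl atQ])
      also have "\<dots> = (\<lambda>j. atoms x - {j}) ` atoms p"
        unfolding im_i ax using b by (intro image_cong refl) blast
      finally have "atoms ` down x = (\<lambda>j. atoms x - {j}) ` insert b (atoms p)"
        unfolding dx using ax b by simp
      then show ?thesis using ax b cp x by (simp add: cubical_def)
    qed
    have inj: "x = y" if x: "l x = Suc k" and y: "l y = Suc k" and eq: "atoms x = atoms y" for x y
    proof (rule ccontr)
      assume "x \<noteq> y"
      have cx: "card (atoms x) = Suc k" "atoms ` down x = (\<lambda>i. atoms x - {i}) ` atoms x"
        using main[OF x] x by (auto simp: cubical_def)
      have cy: "atoms ` down y = (\<lambda>i. atoms x - {i}) ` atoms x"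
        using main[OF y] eq by (auto simp: cubical_def)
      have ex: "\<exists>p. p \<in> down x \<inter> down y \<and> atoms p = atoms x - {i}" if i: "i \<in> atoms x" for i
      proof -
        have "atoms x - {i} \<in> atoms ` down x" unfolding cx(2) using i by auto
        then obtain p where p: "atoms x - {i} = atoms p" "p \<in> down x" by (rule imageE)
        have "atoms x - {i} \<in> atoms ` down y" unfolding cy using i by auto
        then obtain p' where p': "atoms x - {i} = atoms p'" "p' \<in> down y" by (rule imageE)
        have "p = p'"
          by (rule IHi) (use p(1) p'(1) level_down[OF p(2)] level_down[OF p'(2)] x y in simp_all)
        then show ?thesis using p p' by (intro exI[of _ p]) simp
      qed
      have "\<not> card (atoms x) \<le> Suc 0" using cx(1) False by simp
      then obtain i j where ij: "i \<in> atoms x" "j \<in> atoms x" "i \<noteq> j"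
        by (auto simp: card_le_Suc0_iff_eq)
      obtain p q where pq: "p \<in> down x \<inter> down y" "atoms p = atoms x - {i}"
        "q \<in> down x \<inter> down y" "atoms q = atoms x - {j}"
        using ex[OF ij(1)] ex[OF ij(2)] by blast
      have "p \<noteq> q" using pq ij by auto
      moreover have "card {p, q} \<le> card (down x \<inter> down y)" using pq by (intro card_mono) auto
      ultimately show False
        using card_down_Int_le[of x y] x y \<open>x \<noteq> y\<close> by simp
    qed
    show ?thesis using main inj by blast
  qed
qed

lemma card_atoms: "card (atoms x) = l x"
  and atoms_down: "atoms ` down x = (\<lambda>i. atoms x - {i}) ` atoms x"
  using cubical_inj[of "l x"] by (auto simp: cubical_def)

lemma inj_atoms: "inj atoms"
proof (rule injI)
  fix x y assume eq: "atoms x = atoms y"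
  then have "l y = l x" by (simp add: card_atoms[symmetric])
  then show "x = y" using cubical_inj[of "l x"] eq by blast
qed

lemma atoms_symdiff: "E x y \<longleftrightarrow> card ((atoms x - atoms y) \<union> (atoms y - atoms x)) = 1"
proof -
  have down: "y \<in> down x \<longleftrightarrow> (\<exists>i\<in>atoms x. atoms y = atoms x - {i})" for x y
  proof -
    have "y \<in> down x \<longleftrightarrow> atoms y \<in> atoms ` down x"
      by (rule inj_image_mem_iff[OF inj_atoms, symmetric])
    then show ?thesis unfolding atoms_down by auto
  qed
  have E: "E x y \<longleftrightarrow> y \<in> down x \<or> x \<in> down y"
    using level_edge symE by (auto simp: down_def)
  show ?thesis
  proof
    assume "E x y"
    then have "\<exists>i. (atoms x - atoms y) \<union> (atoms y - atoms x) = {i}"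
      unfolding E down by blast
    then show "card ((atoms x - atoms y) \<union> (atoms y - atoms x)) = 1" by auto
  next
    assume "card ((atoms x - atoms y) \<union> (atoms y - atoms x)) = 1"
    then obtain i where i: "(atoms x - atoms y) \<union> (atoms y - atoms x) = {i}"
      by (rule card_1_singletonE)
    show "E x y"
    proof (cases "i \<in> atoms x")
      case True
      then have "atoms y = atoms x - {i}" using i by blast
      then show ?thesis unfolding E down using True by blast
    next
      case False
      have "i \<in> (atoms x - atoms y) \<union> (atoms y - atoms x)" unfolding i by simp
      with False have iy: "i \<in> atoms y" by simp
      have "(atoms y - atoms x) \<union> (atoms x - atoms y) = {i}" using i by (simp only: Un_commute)
      then have "atoms x = atoms y - {i}" using iy by blast
      with iy show ?thesis unfolding E down by blast
    qed
  qed
qed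

text \<open>All atoms are neighbours of \<open>r\<close>, so there are at most \<open>D\<close>;
  since \<open>t\<close> lies on level \<open>D\<close>, it is above all of them and there are
  exactly \<open>D\<close>. Descending from \<open>t\<close> removes atoms one at a time and reaches
  every subset.\<close>

theorem iso_hypercube: "iso_hypercube E D"
proof -
  define I where "I = {a. l a = 1}"
  have "I \<subseteq> nbrs E r"
  proof
    fix a assume "a \<in> I"
    then have a: "l a = 1" by (simp add: I_def)
    then have "down a \<noteq> {}" using card_down'[of a] by auto
    then obtain b where b: "b \<in> down a" by auto
    then have "b = r" using level_down[OF b] a root by simp
    then show "a \<in> nbrs E r" using b symE by (auto simp: down_def)
  qed
  then have card_I_le: "card I \<le> D" using card_mono[of "nbrs E r" I] regular[of r] by simp
  have sub: "atoms x \<subseteq> I" for x using below_level by (auto simp: atoms_def I_def)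
  have at: "atoms t = I"
    by (rule card_seteq) (use sub card_I_le card_atoms[of t] top in auto)
  then have card_I: "card I = D" using card_atoms[of t] top by simp
  have ex: "\<exists>x. atoms x = I - C" if "finite C" "C \<subseteq> I" for C
    using that
  proof (induction C rule: finite_induct)
    case empty
    then show ?case using at by auto
  next
    case (insert c C)
    then obtain x where x: "atoms x = I - C" by auto
    then have "c \<in> atoms x" using insert by auto
    then have "atoms x - {c} \<in> atoms ` down x" unfolding atoms_down by blast
    then obtain y where "atoms x - {c} = atoms y" by blast
    then have "atoms y = I - insert c C" using x by auto
    then show ?case by blast
  qed
  have bij_atoms: "bij_betw atoms UNIV (Pow I)"
    unfolding bij_betw_def
  proof
    show "inj atoms" by (rule inj_atoms)
    show "range atoms = Pow I"
    proof
      show "Pow I \<subseteq> range atoms"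
      proof
        fix B assume "B \<in> Pow I"
        then have "I - (I - B) = B" by auto
        moreover obtain x where "atoms x = I - (I - B)" using ex[of "I - B"] by auto
        ultimately show "B \<in> range atoms" by auto
      qed
    qed (use sub in auto)
  qed
  obtain \<beta> where \<beta>: "bij_betw \<beta> I {1..D}"
    using finite_same_card_bij[of I "{1..D}"] card_I by auto
  have inj: "inj_on \<beta> I" using \<beta> by (simp add: bij_betw_def)
  define f where "f x = \<beta> ` atoms x" for x
  have "bij_betw ((`) \<beta> \<circ> atoms) UNIV (Pow {1..D})"
    by (rule bij_betw_trans[OF bij_atoms bij_betw_Pow[OF \<beta>]])
  then have "bij_betw f UNIV (Pow {1..D})" by (simp add: f_def[abs_def] comp_def)
  moreover have "card ((f x - f y) \<union> (f y - f x)) = card ((atoms x - atoms y) \<union> (atoms y - atoms x))" for x y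
  proof -
    have "(f x - f y) \<union> (f y - f x) = \<beta> ` ((atoms x - atoms y) \<union> (atoms y - atoms x))"
      unfolding f_def image_Un
      using inj_on_image_set_diff[OF inj, of "atoms x" "atoms y"]
        inj_on_image_set_diff[OF inj, of "atoms y" "atoms x"] sub by (metis Diff_subset subset_trans)
    moreover have "inj_on \<beta> ((atoms x - atoms y) \<union> (atoms y - atoms x))"
      by (rule inj_on_subset[OF inj]) (use sub in blast)
    ultimately show ?thesis by (simp add: card_image)
  qed
  ultimately show ?thesis unfolding iso_hypercube_def using atoms_symdiff by auto
qed

end

subsection \<open>Rigidity\<close>

context bakry_emery
begin

theorem diam_imp_hypercube:
  assumes "real (diam E) = 2 * D / K"
  shows "iso_hypercube E D"
proof -
  obtain r t where rt: "gdist E r t = diam E" by (rule diam_attained)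
  define l where "l = gdist E r"
  define f where "f x = real (l x)" for x
  have "f t - f r = 2 * D / K" using assms rt by (simp add: f_def l_def)
  moreover have "Gam E f f x \<le> D / 2" for x
    using gdist_Gam_le[of r x] by (simp add: f_def[abs_def] l_def)
  ultimately obtain c where c: "\<And>x. lap E f x = c - K * f x" and G: "\<And>x. Gam E f f x = D / 2"
    using osc_rigidity[of f t r] by blast
  have le1: "(f y - f x)\<^sup>2 \<le> 1" if "E x y" for x y
    using gdist_edge[OF that, of r] by (simp add: f_def l_def abs_square_le_1)
  have sum_sq: "(\<Sum>y\<in>nbrs E x. (f y - f x)\<^sup>2) = D" for x
    using G[of x] by (simp add: Gam_self)
  \<comment> \<open>At most \<open>D\<close> squares, each at most 1, add up to \<open>D\<close>:
    there are exactly \<open>D\<close> of them, and all equal 1.\<close>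
  have regular: "card (nbrs E x) = D" for x
  proof -
    have "(\<Sum>y\<in>nbrs E x. (f y - f x)\<^sup>2) \<le> (\<Sum>y\<in>nbrs E x. 1)"
      by (intro sum_mono) (simp add: le1)
    then show ?thesis using sum_sq[of x] deg_le[of x] by simp
  qed
  have sq1: "(f y - f x)\<^sup>2 = 1" if "E x y" for x y
  proof -
    have "(\<Sum>y\<in>nbrs E x. 1 - (f y - f x)\<^sup>2) = 0"
      by (simp add: sum_subtractf sum_sq regular)
    then have "\<forall>y\<in>nbrs E x. 1 - (f y - f x)\<^sup>2 = 0"
      by (subst (asm) sum_nonneg_eq_0_iff) (use le1 in auto)
    then show ?thesis using that by simp
  qed
  have level_edge: "l y = Suc (l x) \<or> l x = Suc (l y)" if "E x y" for x y
  proof -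
    have "f y - f x = 1 \<or> f y - f x = - 1" using sq1[OF that] by (simp add: power2_eq_1_iff)
    then show ?thesis by (auto simp: f_def)
  qed
  have root: "l x = 0 \<longleftrightarrow> x = r" for x using gdist_eq_0_iff[OF conn] by (auto simp: l_def)
  have lr: "l r = 0" using root by simp
  have "lap E f r = (\<Sum>y\<in>nbrs E r. 1)"
    unfolding lap_def
  proof (rule sum.cong)
    fix y assume "y \<in> nbrs E r"
    then have "E r y" by simp
    then show "f y - f r = 1" using level_edge[of r y] lr by (simp add: f_def)
  qed simp
  \<comment> \<open>All neighbours of \<open>r\<close> lie on level 1, so the Laplacian at
    \<open>r\<close> fixes the constant.\<close>
  then have cD: "c = D" using c[of r] regular[of r] lr by (simp add: f_def[of r])
  \<comment> \<open>The Laplacian of \<open>f\<close> is \<open>D\<close> minus twice the number of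
    lower neighbours, and also \<open>D - K * f x\<close>.\<close>
  have down: "2 * real (card {y. E x y \<and> l x = Suc (l y)}) = K * l x" for x
  proof -
    have "lap E f x = (\<Sum>y\<in>nbrs E x. 1 - (if l x = Suc (l y) then 2 else 0))"
      unfolding lap_def
    proof (rule sum.cong)
      fix y assume "y \<in> nbrs E x"
      then have "E x y" by simp
      from level_edge[OF this] show "f y - f x = 1 - (if l x = Suc (l y) then 2 else 0)"
        by (auto simp: f_def)
    qed simp
    also have "\<dots> = D - 2 * real (card (nbrs E x \<inter> {y. l x = Suc (l y)}))"
      by (simp add: sum_subtractf regular sum.If_cases)
    also have "nbrs E x \<inter> {y. l x = Suc (l y)} = {y. E x y \<and> l x = Suc (l y)}" by auto
    finally show ?thesis using c[of x] cD by (simp add: f_def[of x])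
  qed
  have "nbrs E r \<noteq> {}" using regular[of r] D_pos by (metis card.empty less_irrefl)
  then obtain a where a: "E r a" by auto
  have la: "l a = 1" using level_edge[OF a] lr by simp
  have "{y. E a y \<and> l a = Suc (l y)} = {r}" using la root lr symE[OF a] by auto
  \<comment> \<open>A neighbour of \<open>r\<close> has exactly one lower neighbour, namely
    \<open>r\<close>.\<close>
  then have K2: "K = 2" using down[of a] la by simp
  \<comment> \<open>Levels change parity along every edge, so there is no odd cycle.\<close>
  have triangle_free: "\<not> E x z" if "E x y" "E y z" for x y z
    using level_edge[OF that(1)] level_edge[OF that(2)] level_edge[of x z] by linarith
  have updown: "card {y \<in> common_nbrs E x z. l y = Suc (l x)} = card {y \<in> common_nbrs E x z. l x = Suc (l y)}"
    if "l x = l z" "x \<noteq> z" for x z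
  proof -
    let ?C = "common_nbrs E x z"
    have "\<not> E x z" using level_edge[of x z] that(1) by auto
    moreover have "Gam2 E f f x = K * Gam E f f x"
      by (rule eigenfunction_Gam_const(2)[OF conn CD c])
    ultimately have "(\<Sum>y\<in>?C. f z - 2 * f y + f x) = 0"
      using midpoint_sum[OF CD] that(2) by blast
    \<comment> \<open>Between two vertices of equal level, a lower midpoint has second difference 2
      and an upper one -2.\<close>
    moreover have "(\<Sum>y\<in>?C. f z - 2 * f y + f x) =
      (\<Sum>y\<in>?C. (if l x = Suc (l y) then 2 else 0) - (if l y = Suc (l x) then 2 else 0))"
    proof (rule sum.cong)
      fix y assume "y \<in> ?C"
      then have "E x y" by simp
      from level_edge[OF this] that(1)
      show "f z - 2 * f y + f x = (if l x = Suc (l y) then 2 else 0) - (if l y = Suc (l x) then 2 else 0)"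
        by (auto simp: f_def)
    qed simp
    ultimately have "real (card (?C \<inter> {y. l x = Suc (l y)})) = real (card (?C \<inter> {y. l y = Suc (l x)}))"
      by (simp add: sum_subtractf sum.If_cases)
    moreover have "?C \<inter> {y. l x = Suc (l y)} = {y \<in> ?C. l x = Suc (l y)}"
      "?C \<inter> {y. l y = Suc (l x)} = {y \<in> ?C. l y = Suc (l x)}" by auto
    ultimately show ?thesis by simp
  qed
  have top: "l t = D" using rt assms K2 by (simp add: l_def)
  have "levelled_graph E l D r t"
  proof
    show "card {y. E x y \<and> l x = Suc (l y)} = l x" for x
      using down[of x] K2 by simp
    show "(\<Sum>z\<in>nbrs E u - {x}. 1 / real (card (common_nbrs E x z))) \<le> (real D - 1) / 2"
      if "E x u" for x u
      by (rule sum_inverse_common_nbrs_le[OF symE irrefl regular triangle_free _ that])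
        (use CD K2 in simp_all)
  qed (fact symE level_edge regular updown root top)+
  then show ?thesis by (rule levelled_graph.iso_hypercube)
qed

end

section \<open>Eigenvalue \<open>K\<close> with multiplicity at least \<open>D\<close>\<close>

locale bakry_emery_eigenspace = bakry_emery +
  fixes B :: "(real^'a) set"
  assumes independent: "independent B"
    and card_B: "card B = D"
    and eigen: "v \<in> B \<Longrightarrow> lap E (\<lambda>z. v $ z) x = - (K * v $ x)"
begin

definition eigenspace :: "(real^'a) set" where
  "eigenspace = {v. \<forall>x. lap E (\<lambda>z. v $ z) x = - (K * v $ x)}"

lemma subspace_eigenspace: "subspace eigenspace"
proof (rule subspaceI)
  show "v + w \<in> eigenspace" if "v \<in> eigenspace" "w \<in> eigenspace" for v w
  proof -
    have add: "lap E (\<lambda>z. (v + w) $ z) x = lap E (\<lambda>z. v $ z) x + 1 * lap E (\<lambda>z. w $ z) x" for x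
      unfolding lap_add_mult[symmetric] by simp
    show ?thesis unfolding eigenspace_def mem_Collect_eq
    proof
      fix x
      have "lap E (\<lambda>z. v $ z) x = - (K * v $ x)" "lap E (\<lambda>z. w $ z) x = - (K * w $ x)"
        using that by (simp_all add: eigenspace_def)
      then show "lap E (\<lambda>z. (v + w) $ z) x = - (K * (v + w) $ x)"
        unfolding add by (simp add: algebra_simps)
    qed
  qed
  show "c *\<^sub>R v \<in> eigenspace" if "v \<in> eigenspace" for c v
  proof -
    have mult: "lap E (\<lambda>z. (c *\<^sub>R v) $ z) x = c * lap E (\<lambda>z. v $ z) x" for x
      unfolding lap_mult[symmetric] by simp
    show ?thesis unfolding eigenspace_def mem_Collect_eq
    proof
      fix x
      have "lap E (\<lambda>z. v $ z) x = - (K * v $ x)" using that by (simp add: eigenspace_def)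
      then show "lap E (\<lambda>z. (c *\<^sub>R v) $ z) x = - (K * (c *\<^sub>R v) $ x)"
        unfolding mult by simp
    qed
  qed
qed (simp add: eigenspace_def lap_def)

lemma span_B_subset: "span B \<subseteq> eigenspace"
  by (rule span_minimal[OF _ subspace_eigenspace]) (use eigen in \<open>auto simp: eigenspace_def\<close>)

lemma eigen_Gam:
  assumes "v \<in> eigenspace"
  shows "Gam E (\<lambda>z. v $ z) (\<lambda>z. v $ z) x = Gam E (\<lambda>z. v $ z) (\<lambda>z. v $ z) y"
    and "Gam2 E (\<lambda>z. v $ z) (\<lambda>z. v $ z) x = K * Gam E (\<lambda>z. v $ z) (\<lambda>z. v $ z) x"
proof -
  have "lap E (\<lambda>z. v $ z) x = 0 - K * v $ x" for x using assms by (simp add: eigenspace_def)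
  from eigenfunction_Gam_const[OF conn CD this]
  show "Gam E (\<lambda>z. v $ z) (\<lambda>z. v $ z) x = Gam E (\<lambda>z. v $ z) (\<lambda>z. v $ z) y"
    and "Gam2 E (\<lambda>z. v $ z) (\<lambda>z. v $ z) x = K * Gam E (\<lambda>z. v $ z) (\<lambda>z. v $ z) x" by blast+
qed

text \<open>\<Gamma> v vanishes at \<open>x\<close>, hence everywhere because it is constant; then
  \<open>v\<close> is constant, and a constant eigenfunction for \<open>K > 0\<close> is
  zero.\<close>

lemma eigen_zero:
  assumes "v \<in> eigenspace" "\<And>y. E x y \<Longrightarrow> v $ y = v $ x"
  shows "v = 0"
proof -
  have "Gam E (\<lambda>z. v $ z) (\<lambda>z. v $ z) x = 0" using assms(2) by (simp add: Gam_self)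
  then have "Gam E (\<lambda>z. v $ z) (\<lambda>z. v $ z) y = 0" for y
    using eigen_Gam(1)[OF assms(1), of y x] by simp
  then have const: "v $ y = v $ z" for y z by (rule Gam_zero_const[OF conn])
  have "lap E (\<lambda>z. v $ z) y = 0" for y
    unfolding lap_def by (intro sum.neutral ballI, subst right_minus_eq, rule const)
  then show ?thesis using assms(1) K_pos by (simp add: eigenspace_def vec_eq_iff)
qed

text \<open>Restricting an eigenfunction to its differences at \<open>x\<close> is injective, because \<open>\<Gamma>\<close> is constant;
  as there are at most \<open>D\<close> neighbours, it is onto.\<close>

lemma eigen_gradient:
  shows "card (nbrs E x) = D"
    and "\<exists>v\<in>eigenspace. \<forall>y. E x y \<longrightarrow> v $ y - v $ x = g y"
proof -
  define T :: "real^'a \<Rightarrow> real^'a" where "T v = (\<chi> y. if E x y then v $ y - v $ x else 0)" for v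
  define U :: "(real^'a) set" where "U = {v. \<forall>y. y \<notin> nbrs E x \<longrightarrow> v $ y = 0}"
  have dimU: "dim U = card (nbrs E x)"
    unfolding U_def dim_vec_eq[symmetric] by (rule dim_substandard_cart)
  have lin: "linear T"
    by (rule linearI) (auto simp: T_def vec_eq_iff algebra_simps)
  have inj: "inj_on T (span B)"
  proof (rule inj_onI)
    fix v w assume vw: "v \<in> span B" "w \<in> span B" "T v = T w"
    have "v - w \<in> eigenspace"
      using span_B_subset vw by (intro subspace_diff[OF subspace_eigenspace]) auto
    moreover have "(v - w) $ y = (v - w) $ x" if "E x y" for y
    proof -
      have "T v $ y = T w $ y" using vw(3) by simp
      then show ?thesis using that by (simp add: T_def)
    qed
    ultimately have "v - w = 0" by (rule eigen_zero)
    then show "v = w" by simp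
  qed
  have ind: "independent (T ` B)"
    by (rule linear_independent_injective_image[OF lin independent inj])
  have "card (T ` B) = D"
    using card_image[OF inj_on_subset[OF inj span_superset]] card_B by simp
  note cardT = this
  have sub: "T ` B \<subseteq> U" by (auto simp: T_def U_def)
  \<comment> \<open>\<open>T\<close> sends the \<open>D\<close> basis vectors to independent vectors
    supported on the neighbours of \<open>x\<close>, so these number at least \<open>D\<close> and
    the image fills \<open>U\<close>.\<close>
  have "D \<le> dim U" using independent_card_le_dim[OF sub ind] cardT by simp
  then show "card (nbrs E x) = D" using dimU deg_le[of x] by simp
  then have "U \<subseteq> span (T ` B)"
    by (intro card_ge_dim_independent[OF sub ind]) (simp add: dimU cardT)
  also have "\<dots> = T ` span B" by (rule linear_span_image[OF lin])
  finally have UT: "U \<subseteq> T ` span B" .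
  have "(\<chi> y. if E x y then g y else 0) \<in> U" by (simp add: U_def)
  then obtain v where v: "v \<in> span B" "(\<chi> y. if E x y then g y else 0) = T v"
    using UT by blast
  have "v $ y - v $ x = g y" if "E x y" for y
  proof -
    have "T v $ y = g y" unfolding v(2)[symmetric] using that by simp
    then show ?thesis using that by (simp add: T_def)
  qed
  then show "\<exists>v\<in>eigenspace. \<forall>y. E x y \<longrightarrow> v $ y - v $ x = g y"
    using v(1) span_B_subset by blast
qed

text \<open>The eigenfunction whose gradient at \<open>x\<close> is 1 in direction \<open>y\<close>
  and 0 otherwise has \<Gamma> v = 1/2, also at \<open>y\<close>. The edge back to \<open>x\<close>
  already accounts for that, so \<open>v\<close> is constant along the other edges at
  \<open>y\<close>.\<close>

lemma eigen_coordinate: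
  assumes "E x y"
  obtains v where "v \<in> eigenspace" "v $ y = v $ x + 1"
    "\<forall>y'. E x y' \<longrightarrow> y' \<noteq> y \<longrightarrow> v $ y' = v $ x"
    "\<forall>z. E y z \<longrightarrow> z \<noteq> x \<longrightarrow> v $ z = v $ y"
proof -
  obtain v where v: "v \<in> eigenspace" "\<And>y'. E x y' \<Longrightarrow> v $ y' - v $ x = (if y' = y then 1 else 0)"
    using eigen_gradient(2)[of x "\<lambda>y'. if y' = y then 1 else 0"] by blast
  have vy: "v $ y = v $ x + 1" using v(2)[OF assms] by simp
  have "(\<Sum>y'\<in>nbrs E x. (v $ y' - v $ x)\<^sup>2) = (\<Sum>y'\<in>nbrs E x. if y' = y then 1 else 0)"
    by (intro sum.cong) (auto simp: v(2))
  then have "(\<Sum>y'\<in>nbrs E x. (v $ y' - v $ x)\<^sup>2) = 1" using assms by simp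
  then have sum1: "(\<Sum>z\<in>nbrs E y. (v $ z - v $ y)\<^sup>2) = 1"
    using eigen_Gam(1)[OF v(1), of y x] by (simp add: Gam_self)
  have yx: "E y x" using symE[OF assms] .
  have "(\<Sum>z\<in>nbrs E y. (v $ z - v $ y)\<^sup>2) = (v $ x - v $ y)\<^sup>2 + (\<Sum>z\<in>nbrs E y - {x}. (v $ z - v $ y)\<^sup>2)"
    using yx by (intro sum.remove) auto
  then have "(\<Sum>z\<in>nbrs E y - {x}. (v $ z - v $ y)\<^sup>2) = 0" using sum1 vy by simp
  then have "\<forall>z\<in>nbrs E y - {x}. (v $ z - v $ y)\<^sup>2 = 0"
    by (subst (asm) sum_nonneg_eq_0_iff) auto
  then have "\<forall>z. E y z \<longrightarrow> z \<noteq> x \<longrightarrow> v $ z = v $ y" by simp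
  moreover have "\<forall>y'. E x y' \<longrightarrow> y' \<noteq> y \<longrightarrow> v $ y' = v $ x"
  proof (intro allI impI)
    show "v $ y' = v $ x" if "E x y'" "y' \<noteq> y" for y' using v(2)[OF that(1)] that(2) by simp
  qed
  ultimately show ?thesis using that[OF v(1) vy] by blast
qed

text \<open>A coordinate eigenfunction for the edge from \<open>x\<close> to \<open>y\<close> would
  have to agree at \<open>z\<close> with both \<open>v $ x\<close> and \<open>v $ y\<close>.\<close>

lemma triangle_free:
  assumes "E x y" "E y z" shows "\<not> E x z"
proof
  assume xz: "E x z"
  have z: "z \<noteq> x" "z \<noteq> y" using xz assms irrefl by auto
  from assms(1) obtain v where v: "v \<in> eigenspace" "v $ y = v $ x + 1"
    "\<forall>y'. E x y' \<longrightarrow> y' \<noteq> y \<longrightarrow> v $ y' = v $ x" "\<forall>z. E y z \<longrightarrow> z \<noteq> x \<longrightarrow> v $ z = v $ y"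
    by (rule eigen_coordinate)
  have "v $ z = v $ x" using v(3) xz z(2) by blast
  moreover have "v $ z = v $ y" using v(4) assms(2) z(1) by blast
  ultimately show False using v(2) by simp
qed

text \<open>For a coordinate eigenfunction of the edge from \<open>x\<close> to \<open>y\<close>,
  the midpoint \<open>y\<close> has second difference -1 and every other midpoint has 1. Their sum
  is zero, so there are two midpoints.\<close>

lemma eigen_square:
  assumes "E x y" "E y z" "z \<noteq> x"
  obtains y' where "common_nbrs E x z = {y, y'}" "y' \<noteq> y"
proof -
  obtain v where v: "v \<in> eigenspace" and vy: "v $ y = v $ x + 1"
    and vy': "\<forall>y'. E x y' \<longrightarrow> y' \<noteq> y \<longrightarrow> v $ y' = v $ x" and vz: "\<forall>z. E y z \<longrightarrow> z \<noteq> x \<longrightarrow> v $ z = v $ y"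
    using assms(1) by (rule eigen_coordinate)
  let ?C = "common_nbrs E x z"
  have y: "y \<in> ?C" using assms by simp
  have "(\<Sum>w\<in>?C. v $ z - 2 * v $ w + v $ x) = 0"
    by (rule midpoint_sum[OF CD eigen_Gam(2)[OF v]]) (use assms triangle_free in auto)
  also have "(\<Sum>w\<in>?C. v $ z - 2 * v $ w + v $ x) = (\<Sum>w\<in>?C. 1 - (if w = y then 2 else 0))"
    by (intro sum.cong) (use vy vy' vz assms(2,3) in auto)
  also have "\<dots> = real (card ?C) - 2" using y by (simp add: sum_subtractf)
  finally have "card ?C = 2" by simp
  then have "card (?C - {y}) = 1" using y by simp
  then obtain y' where "?C - {y} = {y'}" by (rule card_1_singletonE)
  then show ?thesis using that[of y'] y by blast
qed

theorem diam_eq: "real (diam E) = 2 * D / K"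
proof -
  fix x0 :: 'a
  obtain v where v: "v \<in> eigenspace" and grad: "\<And>y. E x0 y \<Longrightarrow> v $ y - v $ x0 = 1"
    using eigen_gradient(2)[of x0 "\<lambda>_. 1"] by blast
  \<comment> \<open>Unit slope spreads through the squares of \<open>eigen_square\<close>:
    \<open>midpoint_sum\<close> makes the changes of \<open>v\<close> on opposite edges
    equal.\<close>
  have all: "\<forall>y. E x y \<longrightarrow> \<bar>v $ y - v $ x\<bar> = 1" for x
  proof (rule connected_graph_induct[OF conn, where P = "\<lambda>x. \<forall>y. E x y \<longrightarrow> \<bar>v $ y - v $ x\<bar> = 1"])
    show "\<forall>y. E x0 y \<longrightarrow> \<bar>v $ y - v $ x0\<bar> = 1" using grad by simp
    fix u y assume u: "\<forall>y. E u y \<longrightarrow> \<bar>v $ y - v $ u\<bar> = 1" and uy: "E u y"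
    show "\<forall>z. E y z \<longrightarrow> \<bar>v $ z - v $ y\<bar> = 1"
    proof (intro allI impI)
      fix z assume yz: "E y z"
      show "\<bar>v $ z - v $ y\<bar> = 1"
      proof (cases "z = u")
        case True
        then have zu: "v $ z = v $ u" by simp
        have "\<bar>v $ y - v $ u\<bar> = 1" using u uy by blast
        then show ?thesis unfolding zu by linarith
      next
        case False
        obtain y' where y': "common_nbrs E u z = {y, y'}" "y' \<noteq> y"
          using eigen_square[OF uy yz False] by blast
        have "(\<Sum>w\<in>common_nbrs E u z. v $ z - 2 * v $ w + v $ u) = 0"
          by (rule midpoint_sum[OF CD eigen_Gam(2)[OF v]])
            (use False triangle_free[OF uy yz] in auto)
        then have "v $ z - v $ y = v $ y' - v $ u"
          unfolding y'(1) using y'(2) by simp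
        moreover have "y' \<in> common_nbrs E u z" using y'(1) by simp
        ultimately show ?thesis using u by simp
      qed
    qed
  qed
  \<comment> \<open>At a maximum all slopes are -1, whereas at \<open>x0\<close> they are all 1; the
    eigenvalue equation then gives the values D/K and -D/K.\<close>
  obtain p where p: "\<And>x. v $ x \<le> v $ p" using ex_maximum[of "\<lambda>x. v $ x"] by blast
  have "lap E (\<lambda>z. v $ z) p = (\<Sum>y\<in>nbrs E p. - 1)"
    unfolding lap_def
  proof (rule sum.cong)
    fix y assume "y \<in> nbrs E p"
    then have "\<bar>v $ y - v $ p\<bar> = 1" using all by simp
    then show "v $ y - v $ p = - 1" using p[of y] by linarith
  qed simp
  then have "K * v $ p = D"
    using v eigen_gradient(1)[of p] by (simp add: eigenspace_def)
  moreover have "lap E (\<lambda>z. v $ z) x0 = D"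
    unfolding lap_def using grad eigen_gradient(1)[of x0] by simp
  then have "K * v $ x0 = - real D" using v by (simp add: eigenspace_def)
  ultimately have osc: "v $ p - v $ x0 = 2 * D / K" using K_pos by (simp add: field_simps)
  have "v $ p - v $ x0 \<le> \<bar>v $ p - v $ x0\<bar>" by simp
  also have "\<dots> \<le> real (gdist E x0 p) * 1"
    by (rule gdist_lipschitz[OF conn]) (use all in simp)
  also have "\<dots> \<le> diam E" using gdist_le_diam[of E x0 p] by simp
  finally show ?thesis using diam_le_bound osc by simp
qed

end

subsection \<open>The hypercube\<close>

locale hypercube_graph =
  fixes E :: "'a::finite \<Rightarrow> 'a \<Rightarrow> bool" and D :: nat and f :: "'a \<Rightarrow> nat set"
  assumes bij: "bij_betw f UNIV (Pow {1..D})"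
    and edge: "E x y \<longleftrightarrow> card ((f x - f y) \<union> (f y - f x)) = 1"
begin

definition toggle :: "nat \<Rightarrow> nat set \<Rightarrow> nat set" where
  "toggle i A = (if i \<in> A then A - {i} else insert i A)"

text \<open>Transports \<open>toggle\<close> to vertices; for \<open>i\<close> in
  \<open>{1..D}\<close> the choice is determined, since \<open>f\<close> is a bijection onto the
  subsets.\<close>

definition flip :: "nat \<Rightarrow> 'a \<Rightarrow> 'a" where
  "flip i x = (SOME y. f y = toggle i (f x))"

lemma f_inject: "f x = f y \<longleftrightarrow> x = y"
  using bij by (auto simp: bij_betw_def dest: injD)

lemma f_surj: "A \<subseteq> {1..D} \<Longrightarrow> \<exists>x. f x = A"
proof -
  assume "A \<subseteq> {1..D}"
  then have "A \<in> range f" using bij by (simp add: bij_betw_def)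
  then show ?thesis by blast
qed

lemma f_subset: "f x \<subseteq> {1..D}"
  using bij by (auto simp: bij_betw_def)

lemma f_flip: "i \<in> {1..D} \<Longrightarrow> f (flip i x) = toggle i (f x)"
proof -
  assume "i \<in> {1..D}"
  then have "toggle i (f x) \<subseteq> {1..D}" using f_subset[of x] by (auto simp: toggle_def)
  then have "\<exists>y. f y = toggle i (f x)" by (rule f_surj)
  then show ?thesis unfolding flip_def by (rule someI_ex)
qed

lemma flip_flip: "i \<in> {1..D} \<Longrightarrow> flip i (flip i x) = x"
  unfolding f_inject[symmetric] by (auto simp: f_flip toggle_def)

lemma flip_commute: "i \<in> {1..D} \<Longrightarrow> j \<in> {1..D} \<Longrightarrow> flip i (flip j x) = flip j (flip i x)"
  unfolding f_inject[symmetric] by (simp add: f_flip) (auto simp: toggle_def)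

lemma inj_flip: "inj_on (\<lambda>i. flip i x) {1..D}"
proof (rule inj_onI)
  fix i j assume ij: "i \<in> {1..D}" "j \<in> {1..D}" "flip i x = flip j x"
  then have "toggle i (f x) = toggle j (f x)" using f_flip by metis
  then show "i = j" by (auto simp: toggle_def split: if_splits)
qed

lemma nbrs_flip: "nbrs E x = (\<lambda>i. flip i x) ` {1..D}"
proof
  show "nbrs E x \<subseteq> (\<lambda>i. flip i x) ` {1..D}"
  proof
    fix y assume "y \<in> nbrs E x"
    then have "card ((f x - f y) \<union> (f y - f x)) = 1" by (simp add: edge)
    then obtain i where i: "(f x - f y) \<union> (f y - f x) = {i}" by (rule card_1_singletonE)
    then have "i \<in> (f x - f y) \<union> (f y - f x)" by simp
    then have iD: "i \<in> {1..D}" using f_subset[of x] f_subset[of y] by blast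
    have "f y = toggle i (f x)"
    proof (rule set_eqI)
      fix k
      have "k \<in> (f x - f y) \<union> (f y - f x) \<longleftrightarrow> k = i" unfolding i by simp
      then show "k \<in> f y \<longleftrightarrow> k \<in> toggle i (f x)" by (auto simp: toggle_def)
    qed
    then have "f y = f (flip i x)" by (simp only: f_flip[OF iD])
    then have "y = flip i x" by (simp only: f_inject)
    then show "y \<in> (\<lambda>i. flip i x) ` {1..D}" using iD by blast
  qed
  show "(\<lambda>i. flip i x) ` {1..D} \<subseteq> nbrs E x"
  proof
    fix y assume "y \<in> (\<lambda>i. flip i x) ` {1..D}"
    then obtain i where i: "i \<in> {1..D}" "y = flip i x" by blast
    have "(f x - toggle i (f x)) \<union> (toggle i (f x) - f x) = {i}" by (auto simp: toggle_def)
    then show "y \<in> nbrs E x" by (simp add: edge i(2) f_flip[OF i(1)])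
  qed
qed

definition diff :: "nat \<Rightarrow> ('a \<Rightarrow> real) \<Rightarrow> 'a \<Rightarrow> real" where
  "diff i g x = g (flip i x) - g x"

lemma sum_nbrs: "(\<Sum>y\<in>nbrs E x. h y) = (\<Sum>i\<in>{1..D}. h (flip i x))"
  unfolding nbrs_flip sum.reindex[OF inj_flip] comp_def ..

lemma lap_diff: "lap E g x = (\<Sum>i\<in>{1..D}. diff i g x)"
  unfolding lap_def sum_nbrs diff_def ..

lemma Gam_diff: "Gam E g h x = (\<Sum>i\<in>{1..D}. diff i g x * diff i h x) / 2"
  unfolding Gam_eq sum_nbrs diff_def ..

text \<open>The discrete Bochner formula: the second differences \<open>\<partial>\<^sub>j \<partial>\<^sub>i g\<close> commute, and the
  diagonal ones are \<open>- 2 \<partial>\<^sub>i g\<close>.\<close>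

lemma CD_2: "CD_inf E 2"
  unfolding CD_inf_def
proof (intro allI)
  fix g :: "'a \<Rightarrow> real" and x
  let ?I = "{1..D}"
  define s where "s i j = diff i g (flip j x) - diff i g x" for i j
  have 1: "lap E (Gam E g g) x = (\<Sum>j\<in>?I. \<Sum>i\<in>?I. ((diff i g (flip j x))\<^sup>2 - (diff i g x)\<^sup>2) / 2)"
    unfolding lap_diff diff_def[of _ "Gam E g g"] Gam_diff
    by (simp add: sum_divide_distrib sum_subtractf power2_eq_square diff_divide_distrib)
  have lap_step: "diff i (lap E g) x = (\<Sum>j\<in>?I. s i j)" if "i \<in> ?I" for i
    unfolding diff_def[of i "lap E g"] lap_diff sum_subtractf[symmetric]
    by (intro sum.cong refl) (use that in \<open>simp add: s_def diff_def flip_commute\<close>)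
  have "Gam E g (lap E g) x = (\<Sum>i\<in>?I. \<Sum>j\<in>?I. diff i g x * s i j) / 2"
    unfolding Gam_diff sum_distrib_left[symmetric]
    by (intro arg_cong2[of _ _ _ _ "(/)"] sum.cong refl) (simp only: lap_step)
  then have 2: "2 * Gam E g (lap E g) x = (\<Sum>j\<in>?I. \<Sum>i\<in>?I. diff i g x * s i j)"
    by (subst sum.swap) simp
  have "2 * Gam2 E g g x = (\<Sum>j\<in>?I. \<Sum>i\<in>?I. ((diff i g (flip j x))\<^sup>2 - (diff i g x)\<^sup>2) / 2 - diff i g x * s i j)"
    unfolding Gam2_self 1 2 by (simp add: sum_subtractf)
  \<comment> \<open>With a = b + s this is (a^2 - b^2) / 2 - b s = s^2 / 2. Below, only the diagonal
    is kept, where \<open>s j j = - 2 * diff j g x\<close>.\<close>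
  also have "\<dots> = (\<Sum>j\<in>?I. \<Sum>i\<in>?I. (s i j)\<^sup>2 / 2)"
    by (intro sum.cong refl) (simp add: s_def power2_eq_square field_simps)
  also have "\<dots> \<ge> (\<Sum>j\<in>?I. (s j j)\<^sup>2 / 2)"
    by (intro sum_mono member_le_sum) auto
  also have "(\<Sum>j\<in>?I. (s j j)\<^sup>2 / 2) = (\<Sum>j\<in>?I. 2 * (diff j g x * diff j g x))"
    by (intro sum.cong refl) (simp add: s_def diff_def flip_flip power2_eq_square field_simps)
  also have "\<dots> = 4 * Gam E g g x" 
    unfolding Gam_diff sum_distrib_left[symmetric] by simp
  finally show "2 * Gam E g g x \<le> Gam2 E g g x" by simp
qed

section \<open>Characters of the hypercube\<close>

definition sgn_char :: "nat \<Rightarrow> 'a \<Rightarrow> real" where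
  "sgn_char i x = (if i \<in> f x then 1 else - 1)"

lemma sgn_char_flip:
  "j \<in> {1..D} \<Longrightarrow> sgn_char i (flip j x) = (if i = j then - sgn_char i x else sgn_char i x)"
proof -
  assume j: "j \<in> {1..D}"
  have "i \<in> f (flip j x) \<longleftrightarrow> (if i = j then i \<notin> f x else i \<in> f x)"
    unfolding f_flip[OF j] by (cases "j \<in> f x") (auto simp: toggle_def)
  then show ?thesis by (cases "i = j") (simp_all add: sgn_char_def)
qed

lemma lap_sgn_char:
  assumes "i \<in> {1..D}"
  shows "lap E (sgn_char i) x = - 2 * sgn_char i x"
proof -
  have "lap E (sgn_char i) x = (\<Sum>j\<in>{1..D}. if i = j then - 2 * sgn_char i x else 0)"
    unfolding lap_diff by (intro sum.cong) (auto simp: diff_def sgn_char_flip)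
  then show ?thesis using assms by simp
qed

text \<open>The involution \<open>flip i\<close> reverses the sign of every summand. This gives the
  orthogonality of the characters to each other and to the constants.\<close>

lemma sum_flip_odd:
  assumes "i \<in> {1..D}" "\<And>x. h (flip i x) = - h x"
  shows "(\<Sum>x\<in>UNIV. h x) = (0::real)"
proof -
  have "bij (flip i)"
    by (rule o_bij[of "flip i"]) (auto simp: flip_flip[OF assms(1)])
  then have "(\<Sum>x\<in>UNIV. h (flip i x)) = (\<Sum>x\<in>UNIV. h x)"
    by (rule sum.reindex_bij_betw)
  then show ?thesis by (simp add: assms(2) sum_negf)
qed

definition char_vec :: "nat \<Rightarrow> real^'a" where "char_vec i = (\<chi> x. sgn_char i x)"

definition one_vec :: "real^'a" where "one_vec = (\<chi> x. 1)"

lemma inner_char_vec: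
  assumes "i \<in> {1..D}" "j \<in> {1..D}" "i \<noteq> j"
  shows "char_vec i \<bullet> char_vec j = 0"
  unfolding char_vec_def inner_vec_def vec_lambda_beta
  by (rule sum_flip_odd[OF assms(1)]) (use assms in \<open>simp add: sgn_char_flip\<close>)

lemma inner_char_one:
  assumes "i \<in> {1..D}"
  shows "char_vec i \<bullet> one_vec = 0"
  unfolding char_vec_def one_vec_def inner_vec_def vec_lambda_beta
  by (rule sum_flip_odd[OF assms]) (use assms in \<open>simp add: sgn_char_flip\<close>)

lemma char_vec_nonzero: "char_vec i \<noteq> 0" and one_vec_nonzero: "one_vec \<noteq> 0"
  by (auto simp: char_vec_def one_vec_def vec_eq_iff sgn_char_def)

text \<open>Nonzero pairwise orthogonal vectors are independent, and orthogonality also makes them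
  distinct. They supply D + 1 eigenfunctions with eigenvalue at most 2.\<close>

lemma independent_characters:
  "independent (insert one_vec (char_vec ` {1..D}))"
  "card (insert one_vec (char_vec ` {1..D})) = Suc D"
proof -
  have inj: "inj_on char_vec {1..D}"
  proof (rule inj_onI, rule ccontr)
    fix i j assume ij: "i \<in> {1..D}" "j \<in> {1..D}" "char_vec i = char_vec j" "i \<noteq> j"
    have "char_vec j \<bullet> char_vec j = 0" using inner_char_vec[OF ij(1,2,4)] ij(3) by simp
    then show False using char_vec_nonzero[of j] by simp
  qed
  have notin: "one_vec \<notin> char_vec ` {1..D}"
  proof
    assume "one_vec \<in> char_vec ` {1..D}"
    then obtain i where "i \<in> {1..D}" "one_vec = char_vec i" by blast
    then have "one_vec \<bullet> one_vec = 0" using inner_char_one[of i] by simp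
    then show False using one_vec_nonzero by simp
  qed
  show "card (insert one_vec (char_vec ` {1..D})) = Suc D"
    using notin card_image[OF inj] by simp
  have "pairwise orthogonal (char_vec ` {1..D})"
  proof (rule pairwiseI)
    fix v w assume "v \<in> char_vec ` {1..D}" "w \<in> char_vec ` {1..D}" "v \<noteq> w"
    then obtain i j where "v = char_vec i" "w = char_vec j" "i \<in> {1..D}" "j \<in> {1..D}" "i \<noteq> j" by blast
    then show "orthogonal v w" using inner_char_vec by (simp add: orthogonal_def)
  qed
  moreover have "orthogonal one_vec w \<and> orthogonal w one_vec" if "w \<in> char_vec ` {1..D}" for w
  proof -
    from that obtain i where "w = char_vec i" "i \<in> {1..D}" by (rule imageE)
    then show ?thesis using inner_char_one[of i] by (simp add: orthogonal_def inner_commute[of one_vec])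
  qed
  ultimately have "pairwise orthogonal (insert one_vec (char_vec ` {1..D}))"
    by (simp add: pairwise_insert)
  moreover have "0 \<notin> insert one_vec (char_vec ` {1..D})"
  proof
    assume "0 \<in> insert one_vec (char_vec ` {1..D})"
    then show False using one_vec_nonzero char_vec_nonzero by (metis imageE insertE)
  qed
  ultimately show "independent (insert one_vec (char_vec ` {1..D}))"
    by (rule pairwise_orthogonal_independent)
qed

text \<open>The cardinality of \<open>f x\<close> changes by one along an edge and ranges from 0 to
  \<open>D\<close>.\<close>

lemma le_diam:
  assumes "connected_graph E"
  shows "D \<le> diam E"
proof -
  obtain x where x: "f x = {}" using f_surj[of "{}"] by auto
  obtain y where y: "f y = {1..D}" using f_surj[of "{1..D}"] by auto
  have fin: "finite (f u)" for u using f_subset[of u] finite_subset by blast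
  have step: "\<bar>real (card (f v)) - real (card (f u))\<bar> \<le> 1" if "E u v" for u v
  proof -
    have "v \<in> (\<lambda>i. flip i u) ` {1..D}" using that nbrs_flip[of u] by auto
    then obtain i where "i \<in> {1..D}" "v = flip i u" by blast
    then show ?thesis using fin[of u] card_Suc_Diff1[OF fin[of u], of i]
      by (auto simp: f_flip toggle_def)
  qed
  have "\<bar>real (card (f y)) - real (card (f x))\<bar> \<le> real (gdist E x y) * 1"
    by (rule gdist_lipschitz[OF assms step])
  then have "real D \<le> real (gdist E x y)" by (simp add: x y)
  then show ?thesis using gdist_le_diam[of E x y] by simp
qed

end

subsection \<open>Eigenvalues of symmetric matrices\<close>

text \<open>A maximiser \<open>v\<close> of the Rayleigh quotient on the unit sphere of
  \<open>S\<close> is an eigenvector: the first variation vanishes, so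
  \<open>\<mu> *\<^sub>R v - A *v v\<close> is orthogonal to \<open>S\<close>, to which it
  belongs.\<close>

lemma symmetric_eigenvector:
  fixes A :: "real^'n^'n"
  assumes sym: "\<And>x y. x \<bullet> (A *v y) = (A *v x) \<bullet> y"
    and S: "subspace S" "\<And>x. x \<in> S \<Longrightarrow> A *v x \<in> S" "S \<noteq> {0}"
  obtains v \<mu> where "v \<in> S" "norm v = 1" "A *v v = \<mu> *\<^sub>R v"
proof -
  define C where "C = S \<inter> sphere 0 1"
  obtain u where u: "u \<in> S" "u \<noteq> 0" using S subspace_0 by fastforce
  have "(1 / norm u) *\<^sub>R u \<in> C"
    using u subspace_scale[OF S(1) u(1)] by (simp add: C_def)
  then have ne: "C \<noteq> {}" by auto
  have "compact C" unfolding C_def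
    by (rule closed_Int_compact[OF closed_subspace[OF S(1)] compact_sphere])
  moreover have "continuous_on C (\<lambda>x. x \<bullet> (A *v x))"
    by (intro continuous_intros linear_continuous_on linear_linear[THEN iffD1] matrix_vector_mul_linear)
  ultimately obtain v where v: "v \<in> C" "\<And>x. x \<in> C \<Longrightarrow> x \<bullet> (A *v x) \<le> v \<bullet> (A *v v)"
    using continuous_attains_sup[of C "\<lambda>x. x \<bullet> (A *v x)"] ne by auto
  define \<mu> where "\<mu> = v \<bullet> (A *v v)"
  have vS: "v \<in> S" and nv: "norm v = 1" using v(1) by (auto simp: C_def)
  have le: "x \<bullet> (A *v x) \<le> \<mu> * (x \<bullet> x)" if x: "x \<in> S" for x
  proof (cases "x = 0")
    case False
    define y where "y = (1 / norm x) *\<^sub>R x"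
    have "y \<in> C" using False subspace_scale[OF S(1) x] by (simp add: C_def y_def)
    then have "y \<bullet> (A *v y) \<le> \<mu>" using v(2) by (simp add: \<mu>_def)
    moreover have "y \<bullet> (A *v y) = (x \<bullet> (A *v x)) / (norm x)\<^sup>2"
      by (simp add: y_def matrix_vector_mult_scaleR power2_eq_square)
    ultimately show ?thesis using False
      by (simp add: divide_le_eq power2_norm_eq_inner)
  qed simp
  have "\<mu> * (v \<bullet> w) - v \<bullet> (A *v w) = 0" if w: "w \<in> S" for w
  proof (rule psd_kernel[where c = "\<mu> * (w \<bullet> w) - w \<bullet> (A *v w)"])
    fix t :: real
    have "v + t *\<^sub>R w \<in> S" using vS w S(1) by (simp add: subspace_add subspace_scale)
    from le[OF this]
    have "(v + t *\<^sub>R w) \<bullet> (A *v (v + t *\<^sub>R w)) \<le> \<mu> * ((v + t *\<^sub>R w) \<bullet> (v + t *\<^sub>R w))" .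
    moreover have "w \<bullet> (A *v v) = v \<bullet> (A *v w)" using sym[of w v] by (simp add: inner_commute)
    moreover have "v \<bullet> v = 1" using nv by (simp add: power2_norm_eq_inner[symmetric])
    ultimately show "0 \<le> 2 * t * (\<mu> * (v \<bullet> w) - v \<bullet> (A *v w)) + t\<^sup>2 * (\<mu> * (w \<bullet> w) - w \<bullet> (A *v w))"
      by (simp add: \<mu>_def[symmetric] inner_commute[of w v] power2_eq_square algebra_simps)
  qed
  then have orth: "(\<mu> *\<^sub>R v - A *v v) \<bullet> w = 0" if "w \<in> S" for w
    using that sym[of v w] by (simp add: inner_diff_left)
  have "\<mu> *\<^sub>R v - A *v v \<in> S"
    using vS S by (simp add: subspace_diff subspace_scale)
  then have "(\<mu> *\<^sub>R v - A *v v) \<bullet> (\<mu> *\<^sub>R v - A *v v) = 0" by (rule orth)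
  then have "A *v v = \<mu> *\<^sub>R v" by simp
  then show ?thesis using that vS nv by blast
qed

text \<open>Spectral theorem by induction on the dimension: after splitting off a unit eigenvector,
  its orthogonal complement in \<open>S\<close> is again invariant by symmetry.\<close>

lemma symmetric_orthonormal_eigenbasis:
  fixes A :: "real^'n^'n"
  assumes sym: "\<And>x y. x \<bullet> (A *v y) = (A *v x) \<bullet> y"
    and "subspace S" "\<And>x. x \<in> S \<Longrightarrow> A *v x \<in> S"
  shows "\<exists>B. finite B \<and> pairwise orthogonal B \<and> (\<forall>b\<in>B. norm b = 1 \<and> (\<exists>\<mu>. A *v b = \<mu> *\<^sub>R b)) \<and> span B = S"
  using assms(2,3)
proof (induction "dim S" arbitrary: S rule: less_induct)
  case less
  show ?case
  proof (cases "S = {0}")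
    case True
    then show ?thesis by (intro exI[of _ "{}"]) auto
  next
    case False
    obtain v \<mu> where v: "v \<in> S" "norm v = 1" "A *v v = \<mu> *\<^sub>R v"
      using symmetric_eigenvector[OF sym less.prems False] by blast
    have vv: "v \<bullet> v = 1" using v(2) by (simp add: power2_norm_eq_inner[symmetric])
    define T where "T = {x \<in> S. v \<bullet> x = 0}"
    have T: "subspace T"
      using less.prems(1) by (auto simp: T_def subspace_def inner_add_right)
    have AT: "A *v x \<in> T" if "x \<in> T" for x
      using that less.prems(2) sym[of v x] by (simp add: T_def v(3))
    have "v \<notin> T" using vv by (simp add: T_def)
    then have "T \<subset> S" using v(1) unfolding T_def by blast
    then have "span T \<subset> span S" using T less.prems(1) by (simp add: span_eq_iff[THEN iffD2])
    then have "dim T < dim S" by (rule dim_psubset)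
    then obtain B where B: "finite B" "pairwise orthogonal B"
      "\<forall>b\<in>B. norm b = 1 \<and> (\<exists>\<mu>. A *v b = \<mu> *\<^sub>R b)" "span B = T"
      using less.hyps[OF _ T AT] by blast
    have BT: "B \<subseteq> T" using B(4) span_superset by blast
    have "pairwise orthogonal (insert v B)"
      using B(2) BT by (auto simp: pairwise_insert T_def orthogonal_def inner_commute)
    moreover have "span (insert v B) = S"
    proof
      show "span (insert v B) \<subseteq> S"
        by (rule span_minimal[OF _ less.prems(1)]) (use BT v(1) in \<open>auto simp: T_def\<close>)
      show "S \<subseteq> span (insert v B)"
      proof
        fix x assume x: "x \<in> S"
        have "x - (v \<bullet> x) *\<^sub>R v \<in> T"
          using x v(1) less.prems(1) vv
          by (simp add: T_def subspace_diff subspace_scale inner_diff_right)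
        then show "x \<in> span (insert v B)" using B(4) span_breakdown_eq by blast
      qed
    qed
    ultimately show ?thesis using B v by (intro exI[of _ "insert v B"]) auto
  qed
qed

text \<open>Diagonalisation over the polynomial ring: with the eigenvectors as constant columns of
  \<open>P\<close>, the characteristic matrix \<open>X\<close> satisfies
  \<open>X ** P = P ** L\<close> for a diagonal \<open>L\<close>. Orthonormality makes
  \<open>det P\<close> nonzero, so it cancels.\<close>

lemma charpoly_orthonormal_eigenbasis:
  fixes A :: "real^'n^'n" and \<mu> :: "real^'n \<Rightarrow> real"
  assumes B: "finite B" "pairwise orthogonal B" "card B = CARD('n)"
    and b: "\<And>b. b \<in> B \<Longrightarrow> norm b = 1" "\<And>b. b \<in> B \<Longrightarrow> A *v b = \<mu> b *\<^sub>R b"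
  shows "charpoly A = (\<Prod>b\<in>B. [:- \<mu> b, 1:])"
proof -
  obtain e where e: "bij_betw e (UNIV :: 'n set) B"
    using finite_same_card_bij[of "UNIV :: 'n set" B] B by auto
  have eB: "e j \<in> B" for j using e by (auto simp: bij_betw_def)
  define X :: "real poly^'n^'n" where "X = (\<chi> i j. (if i = j then [:0, 1:] else 0) - [:A $ i $ j:])"
  define P :: "real poly^'n^'n" where "P = (\<chi> i j. [:e j $ i:])"
  define L :: "real poly^'n^'n" where "L = (\<chi> i j. if i = j then [:- \<mu> (e j), 1:] else 0)"
  have sum_const: "(\<Sum>k\<in>(UNIV::'n set). [:f k:]) = [:\<Sum>k\<in>UNIV. f k:]" for f :: "'n \<Rightarrow> real"
  proof -
    have "(\<Sum>k\<in>K. [:f k:]) = [:\<Sum>k\<in>K. f k:]" if "finite K" for K :: "'n set"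
      using that by (induction rule: finite_induct) auto
    then show ?thesis by simp
  qed
  have "X ** P = P ** L"
  proof -
    have "(X ** P) $ i $ j = (P ** L) $ i $ j" for i j
    proof -
      have "(X ** P) $ i $ j = (\<Sum>k\<in>UNIV. (if i = k then [:0, e j $ k:] else 0) - [:A $ i $ k * e j $ k:])"
        by (auto simp: matrix_matrix_mult_def X_def P_def algebra_simps intro!: sum.cong)
      also have "\<dots> = [:0, e j $ i:] - [:\<Sum>k\<in>UNIV. A $ i $ k * e j $ k:]"
        by (simp add: sum_subtractf sum_const)
      also have "(\<Sum>k\<in>UNIV. A $ i $ k * e j $ k) = (A *v e j) $ i"
        by (simp add: matrix_vector_mult_def)
      also have "\<dots> = \<mu> (e j) * e j $ i" using b(2)[OF eB] by simp
      also have "[:0, e j $ i:] - [:\<mu> (e j) * e j $ i:] = [:e j $ i:] * [:- \<mu> (e j), 1:]"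
        by simp
      also have "\<dots> = (\<Sum>k\<in>UNIV. if k = j then [:e k $ i:] * [:- \<mu> (e j), 1:] else 0)" by simp
      also have "\<dots> = (P ** L) $ i $ j"
      proof -
        have "(P ** L) $ i $ j = (\<Sum>k\<in>UNIV. [:e k $ i:] * (if k = j then [:- \<mu> (e k), 1:] else 0))"
          by (simp add: matrix_matrix_mult_def P_def L_def del: mult_pCons_left cong: if_cong)
        also have "\<dots> = (\<Sum>k\<in>UNIV. if k = j then [:e k $ i:] * [:- \<mu> (e j), 1:] else 0)"
          by (intro sum.cong) auto
        finally show ?thesis by (rule sym)
      qed
      finally show ?thesis .
    qed
    then show ?thesis by (simp add: vec_eq_iff)
  qed
  then have "det X * det P = det P * det L" by (metis det_mul)
  moreover have "det P \<noteq> 0"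
  proof
    assume "det P = 0"
    have "(transpose P ** P) $ i $ j = (mat 1 :: real poly^'n^'n) $ i $ j" for i j
    proof -
      have "(transpose P ** P) $ i $ j = [:e i \<bullet> e j:]"
        by (simp add: matrix_matrix_mult_def transpose_def P_def sum_const inner_vec_def mult.commute)
      moreover have "e i \<bullet> e j = (if i = j then 1 else 0)"
      proof (cases "i = j")
        case True
        then show ?thesis using b(1)[OF eB[of j]] by (simp add: power2_norm_eq_inner[symmetric])
      next
        case False
        then have "e i \<noteq> e j" using e by (auto simp: bij_betw_def inj_on_def)
        then show ?thesis using B(2) eB False by (auto simp: pairwise_def orthogonal_def)
      qed
      ultimately show ?thesis by (simp add: mat_def one_pCons)
    qed
    then have "transpose P ** P = mat 1" by (simp add: vec_eq_iff)
    then have "det (transpose P) * det P = 1" by (metis det_mul det_I)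
    then show False using \<open>det P = 0\<close> by simp
  qed
  ultimately have "det X = det L" by simp
  also have "\<dots> = (\<Prod>j\<in>UNIV. [:- \<mu> (e j), 1:])"
    by (subst det_diagonal) (auto simp: L_def)
  also have "\<dots> = (\<Prod>b\<in>B. [:- \<mu> b, 1:])"
    by (rule prod.reindex_bij_betw[OF e])
  finally show ?thesis by (simp add: charpoly_def X_def)
qed

section \<open>Root multiplicities and sorted eigenvalue lists\<close>

lemma order_prod_linear_factors:
  fixes xs :: "real list"
  shows "order a (\<Prod>x\<leftarrow>xs. [:- x, 1:]) = count (mset xs) a"
proof (induction xs)
  case (Cons x xs)
  have "(\<Prod>x\<leftarrow>xs. [:- x, 1:]) \<noteq> 0" by (auto simp: prod_list_zero_iff)
  then have "[:- x, 1:] * (\<Prod>x\<leftarrow>xs. [:- x, 1:]) \<noteq> 0" by (simp del: mult_pCons_left)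
  moreover have "order a [:- x, 1:] = (if x = a then 1 else 0)"
    using order_power_n_n[of a 1] by (auto intro: order_0I)
  ultimately show ?case using Cons by (simp add: order_mult del: mult_pCons_left)
qed (simp add: order_0I)

text \<open>Root multiplicities determine the multiset of the list and sortedness its order, so the
  definite description in \<open>eigenvalues\<close> is justified.\<close>

lemma eigenvalues_unique:
  assumes "sorted xs" "charpoly A = (\<Prod>x\<leftarrow>xs. [:- x, 1:])"
  shows "eigenvalues A = xs"
  unfolding eigenvalues_def
proof (rule the_equality)
  fix ys assume ys: "sorted ys \<and> charpoly A = (\<Prod>x\<leftarrow>ys. [:- x, 1:])"
  have "mset ys = mset xs"
  proof (rule multiset_eqI)
    show "count (mset ys) a = count (mset xs) a" for a
      using ys assms(2) by (metis order_prod_linear_factors)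
  qed
  then show "ys = xs" using ys assms(1) by (metis properties_for_sort)
qed (use assms in simp)

lemma eigenvalues_orthonormal_eigenbasis:
  fixes A :: "real^'n^'n" and \<mu> :: "real^'n \<Rightarrow> real"
  assumes B: "finite B" "pairwise orthogonal B" "card B = CARD('n)"
    and b: "\<And>b. b \<in> B \<Longrightarrow> norm b = 1" "\<And>b. b \<in> B \<Longrightarrow> A *v b = \<mu> b *\<^sub>R b"
  shows "sorted (eigenvalues A)" "length (eigenvalues A) = CARD('n)"
    and "length (filter Q (eigenvalues A)) = card {b \<in> B. Q (\<mu> b)}"
proof -
  define xs where "xs = sorted_list_of_multiset (image_mset \<mu> (mset_set B))"
  have mset: "mset xs = image_mset \<mu> (mset_set B)" by (simp add: xs_def)
  have "(\<Prod>x\<leftarrow>xs. [:- x, 1:]) = prod_mset (image_mset (\<lambda>x. [:- x, 1:]) (mset xs))"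
    by (metis mset_map prod_mset_prod_list)
  also have "\<dots> = (\<Prod>b\<in>B. [:- \<mu> b, 1:])"
    unfolding mset by (simp add: prod_unfold_prod_mset image_mset.compositionality comp_def)
  finally have "charpoly A = (\<Prod>x\<leftarrow>xs. [:- x, 1:])"
    using charpoly_orthonormal_eigenbasis[OF B b] by simp
  then have xs: "eigenvalues A = xs"
    by (intro eigenvalues_unique) (simp_all add: xs_def)
  show "sorted (eigenvalues A)" unfolding xs by (simp add: xs_def)
  have "length xs = size (mset xs)" by simp
  also have "\<dots> = card B" unfolding mset by simp
  finally show "length (eigenvalues A) = CARD('n)" unfolding xs using B(3) by simp
  have "length (filter Q xs) = size (filter_mset Q (mset xs))"
    by (metis mset_filter size_mset)
  also have "\<dots> = card {b \<in> B. Q (\<mu> b)}"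
    unfolding mset by (simp add: filter_mset_image_mset B(1))
  finally show "length (filter Q (eigenvalues A)) = card {b \<in> B. Q (\<mu> b)}" unfolding xs .
qed

lemma sorted_nth_filter_le:
  fixes xs :: "'b::linorder list"
  assumes "sorted xs" "k < length xs"
  shows "Suc k \<le> length (filter (\<lambda>x. x \<le> xs ! k) xs)"
proof -
  have "{..k} \<subseteq> {i. i < length xs \<and> xs ! i \<le> xs ! k}"
    using assms by (auto intro: sorted_nth_mono)
  then have "card {..k} \<le> card {i. i < length xs \<and> xs ! i \<le> xs ! k}"
    by (intro card_mono) auto
  then show ?thesis by (simp add: length_filter_conv_card)
qed

lemma sorted_nth_le_filter:
  fixes xs :: "'b::linorder list"
  assumes "sorted xs" "k < length (filter (\<lambda>x. x \<le> c) xs)"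
  shows "xs ! k \<le> c"
proof (rule ccontr)
  assume "\<not> xs ! k \<le> c"
  moreover have k: "k < length xs" using assms(2) length_filter_le less_le_trans by blast
  ultimately have "{i. i < length xs \<and> xs ! i \<le> c} \<subseteq> {..<k}"
    using assms(1) by (auto simp: not_le) (meson leD le_less_trans linorder_not_less sorted_nth_mono order_less_le_trans)
  then have "card {i. i < length xs \<and> xs ! i \<le> c} \<le> card {..<k}"
    by (intro card_mono) auto
  then show False using assms(2) by (simp add: length_filter_conv_card)
qed

lemma sorted_nth_ge_filter:
  fixes xs :: "'b::linorder list"
  assumes "sorted xs" "k < length xs" "length (filter (\<lambda>x. x < c) xs) \<le> k"
  shows "c \<le> xs ! k"
proof (rule ccontr)
  assume "\<not> c \<le> xs ! k"
  then have "{..k} \<subseteq> {i. i < length xs \<and> xs ! i < c}"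
    using assms(1,2) by (auto intro: le_less_trans[OF sorted_nth_mono])
  then have "card {..k} \<le> card {i. i < length xs \<and> xs ! i < c}"
    by (intro card_mono) auto
  then show False using assms(3) by (simp add: length_filter_conv_card)
qed

subsection \<open>Laplacian eigenvalues\<close>

lemma neg_lap_matrix_mult: "(neg_lap_matrix E *v v) $ x = - lap E (\<lambda>z. v $ z) x"
proof -
  have "(\<Sum>y\<in>UNIV. lap E (\<lambda>z. if z = y then 1 else 0) x * v $ y)
    = (\<Sum>y\<in>UNIV. \<Sum>z\<in>nbrs E x. ((if z = y then v $ y else 0) - (if x = y then v $ y else 0)))"
    unfolding lap_def sum_distrib_right by (intro sum.cong refl) auto
  also have "\<dots> = (\<Sum>z\<in>nbrs E x. \<Sum>y\<in>UNIV. ((if z = y then v $ y else 0) - (if x = y then v $ y else 0)))"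
    by (rule sum.swap)
  also have "\<dots> = lap E (\<lambda>z. v $ z) x"
    by (simp add: lap_def sum_subtractf)
  finally show ?thesis
    by (simp add: neg_lap_matrix_def matrix_vector_mult_def sum_negf)
qed

text \<open>The adjacency part is symmetric after exchanging the two summations, and the degree part
  is symmetric termwise.\<close>

lemma lap_self_adjoint:
  assumes "\<And>x y. E x y \<Longrightarrow> E y x"
  shows "(\<Sum>x\<in>UNIV. u x * lap E v x) = (\<Sum>x\<in>UNIV. v x * lap E u x)"
proof -
  have expand: "(\<Sum>x\<in>UNIV. u x * lap E v x) = (\<Sum>x\<in>UNIV. \<Sum>y\<in>UNIV. if E x y then u x * v y - u x * v x else 0)"
    for u v :: "'a \<Rightarrow> real"
  proof -
    have "(\<Sum>y\<in>nbrs E x. h y) = (\<Sum>y\<in>UNIV. if E x y then h y else 0)" for h :: "'a \<Rightarrow> real" and x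
      using sum.inter_filter[of UNIV h "E x"] by simp
    then show ?thesis unfolding lap_def sum_distrib_left by (simp add: right_diff_distrib cong: if_cong)
  qed
  have "(\<Sum>x\<in>UNIV. \<Sum>y\<in>UNIV. if E x y then u x * v y else 0) = (\<Sum>y\<in>UNIV. \<Sum>x\<in>UNIV. if E x y then u x * v y else 0)"
    by (rule sum.swap)
  also have "\<dots> = (\<Sum>x\<in>UNIV. \<Sum>y\<in>UNIV. if E x y then v x * u y else 0)"
    by (intro sum.cong refl) (use assms in \<open>auto simp: mult.commute\<close>)
  finally have swap: "(\<Sum>x\<in>UNIV. \<Sum>y\<in>UNIV. if E x y then u x * v y else 0)
    = (\<Sum>x\<in>UNIV. \<Sum>y\<in>UNIV. if E x y then v x * u y else 0)" .
  have split: "(\<Sum>x\<in>UNIV. \<Sum>y\<in>UNIV. if E x y then u x * v y - u x * v x else 0)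
    = (\<Sum>x\<in>UNIV. \<Sum>y\<in>UNIV. if E x y then u x * v y else 0) - (\<Sum>x\<in>UNIV. \<Sum>y\<in>UNIV. if E x y then u x * v x else 0)"
    for u v :: "'a \<Rightarrow> real"
    unfolding sum_subtractf[symmetric] by (intro sum.cong refl) simp
  have "(\<Sum>x\<in>UNIV. \<Sum>y\<in>UNIV. if E x y then u x * v x else 0)
    = (\<Sum>x\<in>UNIV. \<Sum>y\<in>UNIV. if E x y then v x * u x else 0)"
    by (simp only: mult.commute[of "u _" "v _"])
  then show ?thesis unfolding expand split swap by simp
qed

context bakry_emery
begin

lemma laplacian_eigenbasis:
  obtains B \<mu> where "finite B" "pairwise orthogonal B" "card B = CARD('a)" "independent B" "span B = UNIV"
    "\<And>b. b \<in> B \<Longrightarrow> norm b = 1" "\<And>b. b \<in> B \<Longrightarrow> neg_lap_matrix E *v b = \<mu> b *\<^sub>R b"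
    "\<And>b x. b \<in> B \<Longrightarrow> lap E (\<lambda>z. b $ z) x = - (\<mu> b * b $ x)"
proof -
  have inner: "u \<bullet> (neg_lap_matrix E *v v) = - (\<Sum>x\<in>UNIV. u $ x * lap E (\<lambda>z. v $ z) x)" for u v
    by (simp add: inner_vec_def neg_lap_matrix_mult sum_negf)
  have sym: "u \<bullet> (neg_lap_matrix E *v v) = (neg_lap_matrix E *v u) \<bullet> v" for u v
    unfolding inner_commute[of "neg_lap_matrix E *v u"] inner
    using lap_self_adjoint[where u = "\<lambda>z. u $ z" and v = "\<lambda>z. v $ z", OF symE] by simp
  obtain B where B: "finite B" "pairwise orthogonal B" "span B = UNIV"
    "\<forall>b\<in>B. norm b = 1 \<and> (\<exists>\<mu>. neg_lap_matrix E *v b = \<mu> *\<^sub>R b)"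
    using symmetric_orthonormal_eigenbasis[OF sym subspace_UNIV] by auto
  obtain \<mu> where \<mu>: "\<forall>b\<in>B. neg_lap_matrix E *v b = \<mu> b *\<^sub>R b"
    using B(4) bchoice[of B "\<lambda>b \<mu>. neg_lap_matrix E *v b = \<mu> *\<^sub>R b"] by blast
  have "0 \<notin> B" using B(4) by force
  then have ind: "independent B" by (rule pairwise_orthogonal_independent[OF B(2)])
  have "card B = dim (span B)" using ind by (simp add: dim_eq_card_independent)
  then have "card B = CARD('a)" unfolding B(3) by simp
  moreover have "lap E (\<lambda>z. b $ z) x = - (\<mu> b * b $ x)" if "b \<in> B" for b x
  proof -
    have "(neg_lap_matrix E *v b) $ x = (\<mu> b *\<^sub>R b) $ x" using \<mu> that by simp
    then show ?thesis unfolding neg_lap_matrix_mult by simp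
  qed
  ultimately show ?thesis using that[of B \<mu>] B \<mu> ind by blast
qed

text \<open>Eigenfunctions below \<open>K\<close> are constant by \<open>eigenvalue_ge\<close>, and
  two nonzero constants are never orthogonal.\<close>

lemma small_eigenvalues:
  assumes B: "finite B" "pairwise orthogonal B" and "\<And>b. b \<in> B \<Longrightarrow> norm b = 1"
    and lap: "\<And>b x. b \<in> B \<Longrightarrow> lap E (\<lambda>z. b $ z) x = - (\<mu> b * b $ x)"
  shows "card {b \<in> B. \<mu> b < K} \<le> 1"
proof -
  have const: "b $ x = b $ y" if "b \<in> B" "\<mu> b < K" for b x y
  proof (rule ccontr)
    assume "b $ x \<noteq> b $ y"
    then have "\<mu> b \<ge> K" using eigenvalue_ge[OF conn CD lap[OF that(1)]] by blast
    then show False using that(2) by simp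
  qed
  have "b = c" if b: "b \<in> B" "\<mu> b < K" and c: "c \<in> B" "\<mu> c < K" for b c
  proof (rule ccontr)
    assume "b \<noteq> c"
    then have "b \<bullet> c = 0" using B(2) b c by (auto simp: pairwise_def orthogonal_def)
    fix x
    have "b \<bullet> c = (\<Sum>y\<in>(UNIV :: 'a set). b $ x * c $ x)"
      unfolding inner_vec_def inner_real_def
    proof (rule sum.cong)
      show "b $ y * c $ y = b $ x * c $ x" for y
        by (simp only: const[OF b, of y x] const[OF c, of y x])
    qed simp
    then have "b $ x * c $ x = 0" using \<open>b \<bullet> c = 0\<close> by simp
    then have "(\<forall>y. b $ y = 0) \<or> (\<forall>y. c $ y = 0)"
      using const[OF b, of _ x] const[OF c, of _ x] by (metis mult_eq_0_iff)
    then have "b = 0 \<or> c = 0" by (simp add: vec_eq_iff)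
    then show False using assms(3) b(1) c(1) by force
  qed
  then show ?thesis using B(1) by (simp add: card_le_Suc0_iff_eq)
qed

text \<open>Indices start at 0, so at least D + 1 basis vectors have eigenvalue at most
  \<open>K\<close>. At most one lies strictly below, which leaves \<open>D\<close> independent
  eigenfunctions for \<open>K\<close>.\<close>

theorem eigenvalue_imp_diam:
  assumes "D < CARD('a)" "lap_eigenvalues E ! D = K"
  shows "real (diam E) = 2 * D / K"
proof -
  obtain B \<mu> where B: "finite B" "pairwise orthogonal B" "card B = CARD('a)" "independent B" "span B = UNIV"
    and b: "\<And>b. b \<in> B \<Longrightarrow> norm b = 1" "\<And>b. b \<in> B \<Longrightarrow> neg_lap_matrix E *v b = \<mu> b *\<^sub>R b"
    and lap: "\<And>b x. b \<in> B \<Longrightarrow> lap E (\<lambda>z. b $ z) x = - (\<mu> b * b $ x)"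
    using laplacian_eigenbasis by blast
  note ev = eigenvalues_orthonormal_eigenbasis[OF B(1-3) b]
  have "Suc D \<le> length (filter (\<lambda>x. x \<le> K) (lap_eigenvalues E))"
    using sorted_nth_filter_le[OF ev(1), of D] assms ev(2) by (simp add: lap_eigenvalues_def)
  then have "Suc D \<le> card {b \<in> B. \<mu> b \<le> K}"
    using ev(3)[of "\<lambda>x. x \<le> K"] by (simp add: lap_eigenvalues_def)
  also have "{b \<in> B. \<mu> b \<le> K} = {b \<in> B. \<mu> b < K} \<union> {b \<in> B. \<mu> b = K}" by auto
  also have "card \<dots> \<le> card {b \<in> B. \<mu> b < K} + card {b \<in> B. \<mu> b = K}" by (rule card_Un_le)
  also have "card {b \<in> B. \<mu> b < K} \<le> 1" by (rule small_eigenvalues[OF B(1,2) b(1) lap])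
  finally have "D \<le> card {b \<in> B. \<mu> b = K}" by simp
  then obtain C where C: "C \<subseteq> {b \<in> B. \<mu> b = K}" "card C = D"
    by (rule obtain_subset_with_card_n) blast
  have "bakry_emery_eigenspace E D K C"
  proof unfold_locales
    show "independent C" by (rule independent_mono[OF B(4)]) (use C in blast)
    show "card C = D" by (rule C(2))
    fix v x assume "v \<in> C"
    then have "v \<in> B" "\<mu> v = K" using C(1) by auto
    then show "lap E (\<lambda>z. v $ z) x = - (K * v $ x)" using lap[of v x] by simp
  qed
  then show ?thesis by (rule bakry_emery_eigenspace.diam_eq)
qed

text \<open>Eigenvectors for different eigenvalues are orthogonal, so \<open>C\<close> lies in the
  span of the basis vectors with eigenvalue at most \<open>K\<close>; there are thus at least D + 1
  of these. Conversely at most one eigenvalue is below \<open>K\<close>, and \<open>D > 0\<close>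
  puts index \<open>D\<close> beyond it.\<close>

theorem eigenvalue_eqI:
  assumes C: "independent C" "card C = Suc D"
    and ev: "\<And>w. w \<in> C \<Longrightarrow> \<exists>\<nu>\<le>K. \<forall>x. lap E (\<lambda>z. w $ z) x = - (\<nu> * w $ x)"
  shows "lap_eigenvalues E ! D = K"
proof -
  obtain B \<mu> where B: "finite B" "pairwise orthogonal B" "card B = CARD('a)" "independent B" "span B = UNIV"
    and b: "\<And>b. b \<in> B \<Longrightarrow> norm b = 1" "\<And>b. b \<in> B \<Longrightarrow> neg_lap_matrix E *v b = \<mu> b *\<^sub>R b"
    and lap: "\<And>b x. b \<in> B \<Longrightarrow> lap E (\<lambda>z. b $ z) x = - (\<mu> b * b $ x)"
    using laplacian_eigenbasis by blast
  note evs = eigenvalues_orthonormal_eigenbasis[OF B(1-3) b]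
  have sub: "C \<subseteq> span {b \<in> B. \<mu> b \<le> K}"
  proof
    fix w assume "w \<in> C"
    then obtain \<nu> where \<nu>: "\<nu> \<le> K" "\<forall>x. lap E (\<lambda>z. w $ z) x = - (\<nu> * w $ x)" using ev by blast
    have orth: "w \<bullet> b = 0" if "b \<in> B" "\<not> \<mu> b \<le> K" for b
    proof -
      have "(\<Sum>x\<in>UNIV. w $ x * lap E (\<lambda>z. b $ z) x) = (\<Sum>x\<in>UNIV. b $ x * lap E (\<lambda>z. w $ z) x)"
        by (rule lap_self_adjoint[OF symE])
      then have "- (\<mu> b * (w \<bullet> b)) = - (\<nu> * (w \<bullet> b))"
        by (simp add: lap[OF that(1)] \<nu>(2) inner_vec_def sum_distrib_left sum_negf mult.left_commute mult.commute)
      then show ?thesis using that(2) \<nu>(1) by auto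
    qed
    have "w = (\<Sum>b\<in>B. (w \<bullet> b) *\<^sub>R b)"
      using orthonormal_basis_expand[OF B(2) b(1) _ B(1), of w] B(5) by simp
    also have "\<dots> = (\<Sum>b\<in>{b \<in> B. \<mu> b \<le> K}. (w \<bullet> b) *\<^sub>R b)"
      by (rule sum.mono_neutral_right) (use B(1) orth in auto)
    also have "\<dots> \<in> span {b \<in> B. \<mu> b \<le> K}"
      by (intro span_sum span_scale span_base)
    finally show "w \<in> span {b \<in> B. \<mu> b \<le> K}" .
  qed
  have "card C \<le> card {b \<in> B. \<mu> b \<le> K}"
    using independent_span_bound[OF _ C(1) sub] B(1) by simp
  then have "D < length (filter (\<lambda>x. x \<le> K) (lap_eigenvalues E))"
    using evs(3)[of "\<lambda>x. x \<le> K"] C(2) by (simp add: lap_eigenvalues_def)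
  note len = this
  then have "lap_eigenvalues E ! D \<le> K"
    using sorted_nth_le_filter[of "lap_eigenvalues E" D K] evs(1) by (simp add: lap_eigenvalues_def)
  moreover have "D < length (lap_eigenvalues E)"
    by (rule less_le_trans[OF len length_filter_le])
  moreover have "length (filter (\<lambda>x. x < K) (lap_eigenvalues E)) \<le> D"
    using evs(3)[of "\<lambda>x. x < K"] small_eigenvalues[OF B(1,2) b(1) lap] D_pos
    by (simp add: lap_eigenvalues_def)
  ultimately show ?thesis
    using sorted_nth_ge_filter[of "lap_eigenvalues E" D K] evs(1) by (simp add: lap_eigenvalues_def)
qed

end

section \<open>The equivalences\<close>

lemma connected_graph_nbr:
  fixes E :: "'a::finite \<Rightarrow> 'a \<Rightarrow> bool"
  assumes "connected_graph E" "CARD('a) \<ge> 2"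
  shows "\<exists>y. E x y"
proof (rule ccontr)
  assume no: "\<nexists>y. E x y"
  have "y = x" for y
    by (rule connected_graph_induct[OF assms(1), where P = "\<lambda>z. z = x"]) (use no in auto)
  then have "(UNIV :: 'a set) = {x}" by auto
  then have "CARD('a) = 1" by (metis card.empty card.insert finite.emptyI empty_iff One_nat_def)
  then show False using assms(2) by simp
qed

theorem theorem1:
  fixes E :: "'a::finite \<Rightarrow> 'a \<Rightarrow> bool" and D :: nat
  assumes "simple_graph E" and "CARD('a) \<ge> 2" and "connected_graph E" and "D = max_degree E"
  shows "(iso_hypercube E D \<longleftrightarrow>
            (\<exists>K>0. CD_inf E K \<and> lap_eigenvalues E ! D = K))
       \<and> (iso_hypercube E D \<longleftrightarrow>
            (\<exists>K>0. CD_inf E K \<and> real (diam E) = 2 * real D / K))"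
proof -
  have sym: "E y x" if "E x y" for x y using assms(1) that by (simp add: simple_graph_def)
  have irrefl: "\<not> E x x" for x using assms(1) by (simp add: simple_graph_def)
  have deg: "card (nbrs E x) \<le> D" for x
  proof -
    have "Defs.degree E x \<le> Max (range (Defs.degree E))" by (rule Max_ge) auto
    then show ?thesis using assms(4) by (simp add: max_degree_def degree_def)
  qed
  have "Max (range (Defs.degree E)) \<in> range (Defs.degree E)" by (rule Max_in) auto
  then obtain m where "D = Defs.degree E m"
    unfolding max_degree_def[symmetric] assms(4)[symmetric] by (rule imageE)
  then have m: "card (nbrs E m) = D" by (simp add: degree_def)
  obtain y where "E m y" using connected_graph_nbr[OF assms(3,2)] by blast
  then have "nbrs E m \<noteq> {}" by blast
  then have D_pos: "D > 0" using m by (metis card_gt_0_iff finite)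
  \<comment> \<open>Without loops the degree is less than the number of vertices, so index
    \<open>D\<close> lies within the list of eigenvalues.\<close>
  have "nbrs E m \<subset> UNIV" using irrefl[of m] by auto
  then have D_less: "D < CARD('a)" unfolding m[symmetric] by (intro psubset_card_mono) auto
  have loc: "bakry_emery E D K" if "K > 0" "CD_inf E K" for K
    by unfold_locales (fact sym irrefl assms(3) deg D_pos that)+
  have eigen_diam: "real (diam E) = 2 * real D / K"
    if "K > 0" "CD_inf E K" "lap_eigenvalues E ! D = K" for K
    using bakry_emery.eigenvalue_imp_diam[OF loc[OF that(1,2)] D_less that(3)] by simp
  have diam_iso: "iso_hypercube E D"
    if "K > 0" "CD_inf E K" "real (diam E) = 2 * real D / K" for K
    by (rule bakry_emery.diam_imp_hypercube[OF loc[OF that(1,2)]]) (simp add: that(3))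
  \<comment> \<open>On the hypercube \<open>K = 2\<close> witnesses both conditions; the diameter is
    at most 2D/2 by the curvature bound and at least \<open>D\<close> by cardinalities.\<close>
  have cube: "CD_inf E 2 \<and> lap_eigenvalues E ! D = 2 \<and> real (diam E) = 2 * real D / 2"
    if iso: "iso_hypercube E D"
  proof -
    obtain f where "bij_betw f UNIV (Pow {1..D})"
      "\<forall>x y. E x y \<longleftrightarrow> card ((f x - f y) \<union> (f y - f x)) = 1"
      using iso unfolding iso_hypercube_def by blast
    then interpret cube: hypercube_graph E D f by unfold_locales auto
    interpret bakry_emery E D 2 by (rule loc) (simp_all add: cube.CD_2)
    let ?C = "insert cube.one_vec (cube.char_vec ` {1..D})"
    have "lap_eigenvalues E ! D = 2"
    proof (rule eigenvalue_eqI[OF cube.independent_characters])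
      fix w assume "w \<in> ?C"
      then consider "w = cube.one_vec" | i where "i \<in> {1..D}" "w = cube.char_vec i" by blast
      then show "\<exists>\<nu>\<le>2. \<forall>x. lap E (\<lambda>z. w $ z) x = - (\<nu> * w $ x)"
      proof cases
        case 1
        then show ?thesis by (intro exI[of _ 0]) (simp add: cube.one_vec_def lap_const)
      next
        case 2
        have "(\<lambda>z. w $ z) = cube.sgn_char i" by (simp add: 2(2) cube.char_vec_def)
        then show ?thesis using cube.lap_sgn_char[OF 2(1)]
          by (intro exI[of _ 2]) (simp add: 2(2) cube.char_vec_def)
      qed
    qed
    moreover have "real (diam E) = 2 * real D / 2"
      using cube.le_diam[OF assms(3)] diam_le_bound by simp
    ultimately show ?thesis using cube.CD_2 by blast
  qed
  have two: "(2::real) > 0" by simp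
  show ?thesis using eigen_diam diam_iso cube two by blast
qed

end
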